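(* Let $b$ be a prime and let $\alpha,d\in\mathbb{N}$ with $\alpha\ge2$. Let $\boldsymbol{\gamma}=(\gamma_u)_{u\subset\mathbb{N}}$ be a sequence of non-negative weights indexed by the finite subsets $u$ of $\mathbb{N}$, and for each $s\in\mathbb{N}$ consider the space $H_{s,\alpha,\boldsymbol{\gamma}}$ with weights $(\gamma_u)_{u\subseteq I_s}$, $I_s=\{1,\ldots,s\}$. For $\epsilon>0$ and $s\in\mathbb{N}$ let $N(\epsilon,s)$ be the minimum number of points $N$ such that $\tilde{e}(P_N,H_{s,\alpha,\boldsymbol{\gamma}})\le\epsilon\,\tilde{e}(P_0,H_{s,\alpha,\boldsymbol{\gamma}})$ for some $N$-point set $P_N\subset[0,1)^s$. 1. If there exists $\lambda\in(1/(2\min(\alpha,d)),1]$ such that $$\lim_{s\to\infty}\Big[\sum_{\emptyset\ne u\subseteq I_s}\gamma_u^{\lambda}G_{\alpha,d,\lambda,d}^{|u|}\Big]<\infty,$$ then $N(\epsilon,s)$ is bounded above independently of the dimension $s$. 2. If there exist $\lambda\in(1/(2\min(\alpha,d)),1]$ and $q>0$ such that $$\limsup_{s\to\infty}\Big[\frac{1}{s^q}\sum_{\emptyset\ne u\subseteq I_s}\gamma_u^{\lambda}G_{\alpha,d,\lambda,d}^{|u|}\Big]<\infty,$$ then $N(\epsilon,s)$ depends polynomially on the dimension $s$ (i.e. is bounded above by a polynomial in $s$).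
   Context: Constants: $G_{\alpha,d,\lambda,d}=\tilde{D}_{\alpha,b,d}^{\lambda}\big(-1+(1+C_{\alpha,d,\lambda})^d\big)$ with $C_{\alpha,d,\lambda}=b^{-\alpha\lambda}\max\Big\{\Big(\frac{b-1}{b^{2\min(\alpha,d)}-b}\Big)^{\lambda},\frac{b-1}{b^{2\lambda\min(\alpha,d)}-b}\Big\}$ and $\tilde{D}_{\alpha,b,d}=b^{(2d-1)\alpha}D_{\alpha,b}$, $D_{\alpha,b}=\max_{1\le\nu\le\alpha}\big(C'_{\alpha,b,\nu}+\tilde{C}_{2\alpha,b}b^{-2(\alpha-\nu)}\big)$, $C'_{\alpha,b,\nu}=\sum_{\tau=\nu}^{\alpha}C_{\tau,b}^2b^{-2(\tau-\nu)}$, $C_{1,b}=(2\sin(\pi/b))^{-1}$, $C_{\tau,b}=(1+1/b+1/(b(b+1)))^{\tau-2}/(2\sin(\pi/b))^{\tau}$ for $\tau\ge2$, $\tilde{C}_{2\alpha,b}=2(1+1/b+1/(b(b+1)))^{2\alpha-2}/(2\sin(\pi/b))^{2\alpha}$. Function space: $H_{s,\alpha,\boldsymbol{\gamma}}$ is the reproducing kernel Hilbert space (weighted unanchored Sobolev space of order $\alpha$) of real functions on $[0,1)^s$ with kernel $$K_{s,\alpha,\boldsymbol{\gamma}}(\boldsymbol{x},\boldsymbol{y})=\sum_{u\subseteq I_s}\gamma_u\prod_{j\in u}\Big(\sum_{r=1}^{\alpha}\frac{B_r(x_j)B_r(y_j)}{(r!)^2}+(-1)^{\alpha+1}\frac{B_{2\alpha}(|x_j-y_j|)}{(2\alpha)!}\Big),$$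 $B_r$ the Bernoulli polynomial of degree $r$, empty product $=1$. Errors: for an $N$-point multiset $P_N=\{\boldsymbol{x}_0,\ldots,\boldsymbol{x}_{N-1}\}\subset[0,1)^s$, $e(P_N,H)=\sup_{\|f\|_H\le1}\big|\int_{[0,1)^s}f(\boldsymbol{x})d\boldsymbol{x}-\frac1N\sum_{n=0}^{N-1}f(\boldsymbol{x}_n)\big|$. For $\boldsymbol{\sigma}\in[0,1)^s$, $P_{N,\boldsymbol{\sigma}}=\{\boldsymbol{x}_n\oplus\boldsymbol{\sigma}:0\le n<N\}$, where $\oplus$ is componentwise, digitwise addition modulo $b$ of $b$-adic expansions (expansions with infinitely many digits different from $b-1$). The mean square worst-case error with respect to a random digital shift is $\tilde{e}^2(P_N,H)=\int_{[0,1)^s}e^2(P_{N,\boldsymbol{\sigma}},H)\,d\boldsymbol{\sigma}$, and $\tilde{e}(P_N,H)$ is its non-negative square root. The initial error is $\tilde{e}(P_0,H_{s,\alpha,\boldsymbol{\gamma}})=\sup_{\|f\|\le1}|\int_{[0,1)^s}f(\boldsymbol{x})d\boldsymbol{x}|=\sqrt{\gamma_\emptyset}$.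
   Formalization: The weight of the empty set is assumed to be positive; if it is zero the initial error is zero and N(ε,s) need not exist (for example when the weight of {1} is 1 and all other weights are 0), so the claim fails. *)

theory Defs
  imports
    "HOL-Analysis.Analysis"
    "HOL-Computational_Algebra.Computational_Algebra"
begin

text \<open>
  A Hilbert space of real functions on \<open>X\<close> is given by its carrier \<open>H\<close> and its inner product \<open>ip\<close>,
  which is only constrained on \<open>H\<close>. A function on \<open>X\<close> is represented by the total function that
  extends it by 0. For a given kernel the axioms determine \<open>H\<close>, and \<open>ip\<close> on \<open>H\<close>, uniquely.
\<close>

definition ip_norm :: "(('p \<Rightarrow> real) \<Rightarrow> ('p \<Rightarrow> real) \<Rightarrow> real) \<Rightarrow> ('p \<Rightarrow> real) \<Rightarrow> real" where
  "ip_norm ip f = sqrt (ip f f)"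

locale rkhs =
  fixes X :: "'p set"
    and K :: "'p \<Rightarrow> 'p \<Rightarrow> real"
    and H :: "('p \<Rightarrow> real) set"
    and ip :: "('p \<Rightarrow> real) \<Rightarrow> ('p \<Rightarrow> real) \<Rightarrow> real"
  assumes supp: "f \<in> H \<Longrightarrow> x \<notin> X \<Longrightarrow> f x = 0"
    and zero_mem: "(\<lambda>x. 0) \<in> H"
    and add_mem: "f \<in> H \<Longrightarrow> g \<in> H \<Longrightarrow> (\<lambda>x. f x + g x) \<in> H"
    and scale_mem: "f \<in> H \<Longrightarrow> (\<lambda>x. c * f x) \<in> H"
    and ip_sym: "f \<in> H \<Longrightarrow> g \<in> H \<Longrightarrow> ip f g = ip g f"
    and ip_add: "f \<in> H \<Longrightarrow> g \<in> H \<Longrightarrow> h \<in> H \<Longrightarrow> ip (\<lambda>x. f x + g x) h = ip f h + ip g h"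
    and ip_scale: "f \<in> H \<Longrightarrow> g \<in> H \<Longrightarrow> ip (\<lambda>x. c * f x) g = c * ip f g"
    and ip_nonneg: "f \<in> H \<Longrightarrow> 0 \<le> ip f f"
    and ip_definite: "f \<in> H \<Longrightarrow> ip f f = 0 \<Longrightarrow> f = (\<lambda>x. 0)"
    and complete:
      "(\<And>n. F n \<in> H) \<Longrightarrow>
       (\<And>e. 0 < e \<Longrightarrow> \<exists>M. \<forall>m\<ge>M. \<forall>n\<ge>M. ip_norm ip (\<lambda>x. F m x - F n x) < e) \<Longrightarrow>
       \<exists>f\<in>H. (\<lambda>n. ip_norm ip (\<lambda>x. F n x - f x)) \<longlonglongrightarrow> 0"
    and kernel_mem: "y \<in> X \<Longrightarrow> (\<lambda>x. if x \<in> X then K x y else 0) \<in> H"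
    and reproducing: "f \<in> H \<Longrightarrow> y \<in> X \<Longrightarrow> ip f (\<lambda>x. if x \<in> X then K x y else 0) = f y"

text \<open>Points of \<open>[0,1)^s\<close> are functions on the index set \<open>{1..s}\<close>, undefined elsewhere.\<close>

definition cube :: "nat \<Rightarrow> (nat \<Rightarrow> real) set" where
  "cube s = (\<Pi>\<^sub>E j\<in>{1..s}. {0..<1})"

abbreviation lborel_pow :: "nat \<Rightarrow> (nat \<Rightarrow> real) measure" where
  "lborel_pow s \<equiv> (\<Pi>\<^sub>M j\<in>{1..s}. lborel)"

fun bernoulli_num :: "nat \<Rightarrow> real" where
  "bernoulli_num 0 = 1"
| "bernoulli_num (Suc n) =
     - (\<Sum>k\<le>n. real ((n + 2) choose k) * bernoulli_num k) / real (n + 2)"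

definition bernoulli_poly :: "nat \<Rightarrow> real \<Rightarrow> real" where
  "bernoulli_poly n x = (\<Sum>k\<le>n. real (n choose k) * bernoulli_num k * x ^ (n - k))"

definition sobolev_kernel ::
  "nat \<Rightarrow> nat \<Rightarrow> (nat set \<Rightarrow> real) \<Rightarrow> (nat \<Rightarrow> real) \<Rightarrow> (nat \<Rightarrow> real) \<Rightarrow> real" where
  "sobolev_kernel s \<alpha> \<gamma> x y =
     (\<Sum>u\<in>Pow {1..s}. \<gamma> u * (\<Prod>j\<in>u.
        (\<Sum>r=1..\<alpha>. bernoulli_poly r (x j) * bernoulli_poly r (y j) / (fact r)\<^sup>2)
        + (-1) ^ (\<alpha> + 1) * bernoulli_poly (2 * \<alpha>) \<bar>x j - y j\<bar> / fact (2 * \<alpha>)))"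

definition worst_case_error ::
  "nat \<Rightarrow> ((nat \<Rightarrow> real) \<Rightarrow> real) set \<Rightarrow> (((nat \<Rightarrow> real) \<Rightarrow> real) \<Rightarrow> ((nat \<Rightarrow> real) \<Rightarrow> real) \<Rightarrow> real)
    \<Rightarrow> (nat \<Rightarrow> real) multiset \<Rightarrow> real" where
  "worst_case_error s H ip P =
     (SUP f\<in>{f \<in> H. ip_norm ip f \<le> 1}.
        \<bar>(LINT x:cube s|lborel_pow s. f x) - (\<Sum>x\<in>#P. f x) / real (size P)\<bar>)"

definition initial_error ::
  "nat \<Rightarrow> ((nat \<Rightarrow> real) \<Rightarrow> real) set \<Rightarrow> (((nat \<Rightarrow> real) \<Rightarrow> real) \<Rightarrow> ((nat \<Rightarrow> real) \<Rightarrow> real) \<Rightarrow> real)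
    \<Rightarrow> real" where
  "initial_error s H ip =
     (SUP f\<in>{f \<in> H. ip_norm ip f \<le> 1}. \<bar>LINT x:cube s|lborel_pow s. f x\<bar>)"

text \<open>
  For \<open>x \<in> [0,1)\<close> and \<open>i \<ge> 1\<close>, \<open>digit b x i\<close> is the \<open>i\<close>-th digit after the point in the \<open>b\<close>-adic
  expansion of \<open>x\<close> with infinitely many digits different from \<open>b - 1\<close>.
\<close>

definition digit :: "nat \<Rightarrow> real \<Rightarrow> nat \<Rightarrow> int" where
  "digit b x i = \<lfloor>x * real b ^ i\<rfloor> mod int b"

text \<open>
  For fixed \<open>x\<close> there is at most one \<open>y \<in> [0,1)\<close> for which all digits of the sum are \<open>b - 1\<close>, so that
  the series has the value 1; the set of shifts for which this happens is a null set.
\<close>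

definition digit_add :: "nat \<Rightarrow> real \<Rightarrow> real \<Rightarrow> real" where
  "digit_add b x y =
     (\<Sum>i. real_of_int ((digit b x (Suc i) + digit b y (Suc i)) mod int b) / real b ^ Suc i)"

definition digital_shift ::
  "nat \<Rightarrow> nat \<Rightarrow> (nat \<Rightarrow> real) \<Rightarrow> (nat \<Rightarrow> real) \<Rightarrow> (nat \<Rightarrow> real)" where
  "digital_shift b s \<sigma> x = (\<lambda>j\<in>{1..s}. digit_add b (x j) (\<sigma> j))"

definition rms_error ::
  "nat \<Rightarrow> nat \<Rightarrow> ((nat \<Rightarrow> real) \<Rightarrow> real) set \<Rightarrow> (((nat \<Rightarrow> real) \<Rightarrow> real) \<Rightarrow> ((nat \<Rightarrow> real) \<Rightarrow> real) \<Rightarrow> real)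
    \<Rightarrow> (nat \<Rightarrow> real) multiset \<Rightarrow> real" where
  "rms_error b s H ip P =
     sqrt (LINT \<sigma>:cube s|lborel_pow s.
       (worst_case_error s H ip (image_mset (digital_shift b s \<sigma>) P))\<^sup>2)"

text \<open>The value is \<open>\<infinity>\<close> if no point set achieves the required error.\<close>

definition min_points ::
  "nat \<Rightarrow> nat \<Rightarrow> ((nat \<Rightarrow> real) \<Rightarrow> real) set \<Rightarrow> (((nat \<Rightarrow> real) \<Rightarrow> real) \<Rightarrow> ((nat \<Rightarrow> real) \<Rightarrow> real) \<Rightarrow> real)
    \<Rightarrow> real \<Rightarrow> enat" where
  "min_points b s H ip \<epsilon> =
     Inf {enat N |N. 1 \<le> N \<and> (\<exists>P. size P = N \<and> set_mset P \<subseteq> cube s \<and>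
       rms_error b s H ip P \<le> \<epsilon> * initial_error s H ip)}"

definition C1_const :: "nat \<Rightarrow> nat \<Rightarrow> real" where
  "C1_const b \<tau> =
     (if \<tau> = 1 then 1 / (2 * sin (pi / b))
      else (1 + 1 / b + 1 / (b * (b + 1))) ^ (\<tau> - 2) / (2 * sin (pi / b)) ^ \<tau>)"

definition C1_sum_const :: "nat \<Rightarrow> nat \<Rightarrow> nat \<Rightarrow> real" where
  "C1_sum_const \<alpha> b \<nu> = (\<Sum>\<tau>=\<nu>..\<alpha>. (C1_const b \<tau>)\<^sup>2 / real b ^ (2 * (\<tau> - \<nu>)))"

definition C2_const :: "nat \<Rightarrow> nat \<Rightarrow> real" where
  "C2_const \<alpha> b =
     2 * (1 + 1 / b + 1 / (b * (b + 1))) ^ (2 * \<alpha> - 2) / (2 * sin (pi / b)) ^ (2 * \<alpha>)"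

definition D_const :: "nat \<Rightarrow> nat \<Rightarrow> real" where
  "D_const \<alpha> b =
     Max ((\<lambda>\<nu>. C1_sum_const \<alpha> b \<nu> + C2_const \<alpha> b / real b ^ (2 * (\<alpha> - \<nu>))) ` {1..\<alpha>})"

definition D_tilde_const :: "nat \<Rightarrow> nat \<Rightarrow> nat \<Rightarrow> real" where
  "D_tilde_const \<alpha> b d = real b ^ ((2 * d - 1) * \<alpha>) * D_const \<alpha> b"

definition C_const :: "nat \<Rightarrow> nat \<Rightarrow> nat \<Rightarrow> real \<Rightarrow> real" where
  "C_const b \<alpha> d lam =
     real b powr (- (\<alpha> * lam)) *
     max (((real b - 1) / (real b ^ (2 * min \<alpha> d) - real b)) powr lam)
         ((real b - 1) / (real b powr (2 * lam * real (min \<alpha> d)) - real b))"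

definition G_const :: "nat \<Rightarrow> nat \<Rightarrow> nat \<Rightarrow> real \<Rightarrow> real" where
  "G_const b \<alpha> d lam = D_tilde_const \<alpha> b d powr lam * (- 1 + (1 + C_const b \<alpha> d lam) ^ d)"

definition weight_sum :: "nat \<Rightarrow> nat \<Rightarrow> nat \<Rightarrow> (nat set \<Rightarrow> real) \<Rightarrow> real \<Rightarrow> nat \<Rightarrow> real" where
  "weight_sum b \<alpha> d \<gamma> lam s =
     (\<Sum>u\<in>Pow {1..s} - {{}}. \<gamma> u powr lam * G_const b \<alpha> d lam ^ card u)"

end

theory Submission
  imports Defs "HOL-Probability.Probability_Measure"
begin

text \<open>
  No structured point set is needed. Averaged over the digital shift, the squared worst-case error of
  \<open>x\<^sub>0, \<dots>, x\<^bsub>N-1\<^esub>\<close> is the mean over all pairs of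
  \<open>\<Sum>\<^bsub>u \<noteq> {}\<^esub> \<gamma>\<^sub>u \<Prod>\<^bsub>j \<in> u\<^esub> k(x\<^bsub>n,j\<^esub>, x\<^bsub>m,j\<^esub>)\<close>, where \<open>k\<close> has mean zero in each variable
  and the constant diagonal value \<open>c \<le> 1/9\<close>. Choosing the points one after the other so that the
  cross terms sum to at most 0 leaves the Monte Carlo rate \<open>1/N \<Sum>\<^bsub>u \<noteq> {}\<^esub> \<gamma>\<^sub>u c\<^bsup>|u|\<^esup>\<close>. The constant \<open>G\<close> is
  so large that \<open>c \<le> G\<^bsup>1/\<lambda>\<^esup>\<close>, and Jensen's inequality \<open>\<Sum> t\<^sub>i \<le> (\<Sum> t\<^sub>i\<^bsup>\<lambda>\<^esup>)\<^bsup>1/\<lambda>\<^esup>\<close> bounds the sum by the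
  \<open>1/\<lambda>\<close>-th power of the weight sum.
\<close>

section \<open>Bernoulli polynomials and the univariate kernel\<close>

text \<open>The space \<open>H\<close> is given only by axioms, so even measurability of its members
  has to come from the kernel. By Cauchy-Schwarz, f(x) - f(y) is controlled by kernel values at
  pairs formed from x and y; continuity of the kernel therefore passes to every f, and integrals
  become limits of finite sums over a grid. Products of univariate kernels over a nonempty set have
  mean zero, so integration is represented by the constant \<open>\<gamma> {}\<close>. This is why
  the empty set disappears from the squared error.

  Averaging over the shift requires that digitwise addition of a fixed number preserve integrals.
  Self-similarity gives this for Lipschitz integrands, which covers the piecewise polynomial kernel.

  The bound 1/9 is 1/12 + 1/36: the mean of the square of x - 1/2, plus a geometric tail. The same 9
  appears on the side of G: \<open>sin (pi / b)\<close> has square at most 9/(4 b), so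
  \<open>D_const\<close> is at least b/9, and the remaining powers of b in G never lose more than a
  factor b.\<close>

definition bernoulli_fun :: "nat \<Rightarrow> real \<Rightarrow> real" where
  "bernoulli_fun n x = bernoulli_poly n x / fact n"

lemma bernoulli_poly_0 [simp]: "bernoulli_poly 0 x = 1"
  by (simp add: bernoulli_poly_def)

text \<open>Bernoulli polynomials satisfy B_n' = n B_(n-1). Division by n! absorbs the factor n, so
  each function is an antiderivative of its predecessor and the integrals below can be read
  off.\<close>

lemma bernoulli_fun_has_derivative:
  "(bernoulli_fun (Suc n) has_real_derivative bernoulli_fun n x) (at x within S)"
proof -
  have "((\<lambda>x. \<Sum>k\<le>Suc n. real (Suc n choose k) * bernoulli_num k * x ^ (Suc n - k))
      has_real_derivative
      (\<Sum>k\<le>Suc n. real (Suc n choose k) * bernoulli_num k * (real (Suc n - k) * x ^ (Suc n - k - 1))))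
      (at x within S)"
    by (intro derivative_eq_intros refl sum.cong | simp)+
  also have "(\<Sum>k\<le>Suc n. real (Suc n choose k) * bernoulli_num k * (real (Suc n - k) * x ^ (Suc n - k - 1)))
      = (\<Sum>k\<le>n. real (Suc n choose k) * bernoulli_num k * (real (Suc n - k) * x ^ (n - k)))"
    by (simp only: sum.atMost_Suc) simp
  also have "\<dots> = (\<Sum>k\<le>n. real (Suc n) * (real (n choose k) * bernoulli_num k * x ^ (n - k)))"
  proof (intro sum.cong refl)
    fix k assume "k \<in> {..n}"
    have "real (Suc n - k) * real (Suc n choose k) = real (Suc n) * real (n choose k)"
      using binomial_absorb_comp[of "Suc n" k] by (metis diff_Suc_1 of_nat_mult)
    then have "real (Suc n - k) * real (Suc n choose k) * (bernoulli_num k * x ^ (n - k))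
        = real (Suc n) * real (n choose k) * (bernoulli_num k * x ^ (n - k))"
      by (simp only:)
    then show "real (Suc n choose k) * bernoulli_num k * (real (Suc n - k) * x ^ (n - k))
        = real (Suc n) * (real (n choose k) * bernoulli_num k * x ^ (n - k))"
      by (simp only: mult.assoc mult.left_commute mult.commute)
  qed
  also have "\<dots> = real (Suc n) * bernoulli_poly n x"
    by (simp add: bernoulli_poly_def sum_distrib_left)
  finally have "(bernoulli_poly (Suc n) has_real_derivative real (Suc n) * bernoulli_poly n x) (at x within S)"
    by (simp add: bernoulli_poly_def[abs_def])
  from DERIV_cdivide[OF this, of "fact (Suc n)"] show ?thesis
    by (simp add: bernoulli_fun_def[abs_def] del: of_nat_Suc)
qed

lemma continuous_on_bernoulli_fun: "continuous_on S (bernoulli_fun n)"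
proof -
  have "continuous_on S (\<lambda>x. bernoulli_poly n x / fact n)"
    unfolding bernoulli_poly_def by (intro continuous_intros) auto
  then show ?thesis by (simp add: bernoulli_fun_def[abs_def])
qed

text \<open>The values of B_n at 1 and 0 differ by the sum of (n choose k) B_k over k < n, and the
  recursion for the Bernoulli numbers says that this sum vanishes.\<close>

lemma bernoulli_fun_1_eq_0:
  assumes "2 \<le> n"
  shows "bernoulli_fun n 1 = bernoulli_fun n 0"
proof -
  obtain m where n: "n = Suc (Suc m)"
    using assms by (metis Suc_le_D numeral_2_eq_2 Suc_le_mono)
  have "bernoulli_poly n 0 = (\<Sum>k\<in>{n}. real (n choose k) * bernoulli_num k * 0 ^ (n - k))"
    unfolding bernoulli_poly_def by (rule sum.mono_neutral_right) auto
  then have 0: "bernoulli_poly n 0 = bernoulli_num n" by simp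
  have "bernoulli_poly n 1 = (\<Sum>k\<le>Suc m. real (n choose k) * bernoulli_num k) + bernoulli_num n"
    by (simp add: bernoulli_poly_def n)
  also have "(\<Sum>k\<le>Suc m. real (n choose k) * bernoulli_num k)
      = (\<Sum>k\<le>m. real (n choose k) * bernoulli_num k) + real n * bernoulli_num (Suc m)"
    using binomial_Suc_n[of "Suc m"] by (simp add: n del: bernoulli_num.simps binomial_Suc_Suc binomial_Suc_n)
  also have "\<dots> = 0"
    by (simp add: n field_simps)
  finally show ?thesis using 0 by (simp add: bernoulli_fun_def)
qed

lemma has_integral_bernoulli_fun:
  assumes "a \<le> b"
  shows "(bernoulli_fun n has_integral bernoulli_fun (Suc n) b - bernoulli_fun (Suc n) a) {a..b}"
  using assms bernoulli_fun_has_derivative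
  by (intro fundamental_theorem_of_calculus)
    (auto simp: has_real_derivative_iff_has_vector_derivative[symmetric])

lemma has_integral_bernoulli_fun_minus:
  assumes "a \<le> b"
  shows "((\<lambda>y. bernoulli_fun n (c - y)) has_integral
    bernoulli_fun (Suc n) (c - a) - bernoulli_fun (Suc n) (c - b)) {a..b}"
proof -
  have "((\<lambda>y. - bernoulli_fun (Suc n) (c - y)) has_vector_derivative bernoulli_fun n (c - y))
      (at y within {a..b})" for y
  proof -
    have "((\<lambda>y. c - y) has_real_derivative - 1) (at y within {a..b})"
      by (auto intro!: derivative_eq_intros)
    from DERIV_minus[OF DERIV_chain2[OF bernoulli_fun_has_derivative[of n "c - y" UNIV] this]]
    show ?thesis by (simp add: has_real_derivative_iff_has_vector_derivative[symmetric])
  qed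
  from fundamental_theorem_of_calculus[OF assms this] show ?thesis by simp
qed

lemma bernoulli_fun_has_integral_0:
  assumes "1 \<le> n"
  shows "(bernoulli_fun n has_integral 0) {0..1}"
  using has_integral_bernoulli_fun[of 0 1 n] bernoulli_fun_1_eq_0[of "Suc n"] assms by simp

text \<open>By the induction hypothesis both sides have the same derivative, so they differ by a
  constant. Both have mean zero on the unit interval, hence the constant is 0.\<close>

lemma bernoulli_fun_reflect: "bernoulli_fun n (1 - x) = (-1) ^ n * bernoulli_fun n x"
proof (induction n arbitrary: x)
  case 0
  show ?case by (simp add: bernoulli_fun_def)
next
  case (Suc n)
  define D where "D = (\<lambda>x. bernoulli_fun (Suc n) (1 - x) - (-1) ^ Suc n * bernoulli_fun (Suc n) x)"
  have "(D has_real_derivative 0) (at x)" for x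
  proof -
    have "(D has_real_derivative bernoulli_fun n (1 - x) * (-1) - (-1) ^ Suc n * bernoulli_fun n x) (at x)"
      unfolding D_def
      by (intro DERIV_diff DERIV_cmult bernoulli_fun_has_derivative
          DERIV_chain2[OF bernoulli_fun_has_derivative]) (auto intro!: derivative_eq_intros)
    then show ?thesis by (simp add: Suc.IH)
  qed
  then have const: "D y = D z" for y z
    by (intro DERIV_isconst_all allI)
  have "(D has_integral 0) {0..1}"
  proof -
    have "((\<lambda>x. bernoulli_fun (Suc n) (1 - x)) has_integral 0) {0..1}"
      using has_integral_bernoulli_fun_minus[of 0 1 "Suc n" 1] bernoulli_fun_1_eq_0[of "Suc (Suc n)"]
      by simp
    from has_integral_diff[OF this has_integral_mult_right[OF bernoulli_fun_has_integral_0[of "Suc n"], of "(-1) ^ Suc n"]]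
    show ?thesis by (simp add: D_def)
  qed
  moreover have "(D has_integral D x) {0..1}"
  proof -
    have "D = (\<lambda>_. D x)" using const by auto
    then show ?thesis using has_integral_const_real[of "D x" 0 1] by simp
  qed
  ultimately have "D x = 0" by (rule has_integral_unique[rotated])
  then show ?case by (simp add: D_def)
qed

text \<open>Split at x. The two pieces contribute the values of the next function at x and at 1 - x,
  which cancel by reflection because n + 1 is odd. Its value at 0 vanishes, being equal to the value
  at 1 and, by reflection, to the negative of it.\<close>

lemma has_integral_bernoulli_fun_dist:
  assumes "1 \<le> n" "even n" "x \<in> {0..1}"
  shows "((\<lambda>y. bernoulli_fun n \<bar>x - y\<bar>) has_integral 0) {0..1}"
proof -
  have dr: "((\<lambda>y. bernoulli_fun (Suc n) (y - x)) has_vector_derivative bernoulli_fun n (y - x))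
      (at y within S)" for y S
  proof -
    have "((\<lambda>y. y - x) has_real_derivative 1) (at y within S)"
      by (auto intro!: derivative_eq_intros)
    from DERIV_chain2[OF bernoulli_fun_has_derivative[of n "y - x" UNIV] this]
    show ?thesis by (simp add: has_real_derivative_iff_has_vector_derivative[symmetric])
  qed
  have "((\<lambda>y. bernoulli_fun n (x - y)) has_integral
      bernoulli_fun (Suc n) (x - 0) - bernoulli_fun (Suc n) (x - x)) {0..x}"
    using assms by (intro has_integral_bernoulli_fun_minus) auto
  then have l: "((\<lambda>y. bernoulli_fun n \<bar>x - y\<bar>) has_integral
      bernoulli_fun (Suc n) x - bernoulli_fun (Suc n) 0) {0..x}"
    by (subst has_integral_cong[where g = "\<lambda>y. bernoulli_fun n (x - y)"]) auto
  have "((\<lambda>y. bernoulli_fun n (y - x)) has_integral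
      bernoulli_fun (Suc n) (1 - x) - bernoulli_fun (Suc n) (x - x)) {x..1}"
    using assms by (intro fundamental_theorem_of_calculus dr) auto
  then have r: "((\<lambda>y. bernoulli_fun n \<bar>x - y\<bar>) has_integral
      bernoulli_fun (Suc n) (1 - x) - bernoulli_fun (Suc n) 0) {x..1}"
    by (subst has_integral_cong[where g = "\<lambda>y. bernoulli_fun n (y - x)"]) auto
  have "bernoulli_fun (Suc n) 0 = 0"
    using bernoulli_fun_reflect[of "Suc n" 0] bernoulli_fun_1_eq_0[of "Suc n"] assms by simp
  then show ?thesis
    using has_integral_combine[OF _ _ l r] assms bernoulli_fun_reflect[of "Suc n" x] by simp
qed

text \<open>Because of mean zero, the value at x is the average over y of the differences between
  the values at x and y. Each difference is at most S times the distance of x and y, and that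
  distance has average at most 1/2.\<close>

lemma abs_bernoulli_fun_le_half:
  assumes n: "1 \<le> n" and S: "\<And>y. y \<in> {0..1} \<Longrightarrow> \<bar>bernoulli_fun (n - 1) y\<bar> \<le> S" and x: "x \<in> {0..1}"
  shows "\<bar>bernoulli_fun n x\<bar> \<le> S / 2"
proof -
  have lip: "\<bar>bernoulli_fun n x - bernoulli_fun n y\<bar> \<le> S * \<bar>x - y\<bar>" if "y \<in> {0..1}" for y
    using field_differentiable_bound[of "{0..1}" "bernoulli_fun n" "bernoulli_fun (n - 1)" S y x]
      bernoulli_fun_has_derivative[of "n - 1"] S that x n
    by (simp add: abs_minus_commute)
  have i1: "((\<lambda>y. bernoulli_fun n x - bernoulli_fun n y) has_integral bernoulli_fun n x) {0..1}"
    using has_integral_diff[OF has_integral_const_real[of "bernoulli_fun n x" 0 1] bernoulli_fun_has_integral_0[OF n]]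
    by simp
  have l: "((\<lambda>y. S * \<bar>x - y\<bar>) has_integral S * x\<^sup>2 / 2) {0..x}"
  proof -
    have "((\<lambda>y. S * (x - y)) has_integral - S * (x - x)\<^sup>2 / 2 - - S * (x - 0)\<^sup>2 / 2) {0..x}"
      using x by (intro fundamental_theorem_of_calculus)
        (auto simp: has_real_derivative_iff_has_vector_derivative[symmetric] field_simps
          intro!: derivative_eq_intros)
    then have "((\<lambda>y. S * (x - y)) has_integral S * x\<^sup>2 / 2) {0..x}" by simp
    then show ?thesis by (rule has_integral_cong[THEN iffD1, rotated]) auto
  qed
  have r: "((\<lambda>y. S * \<bar>x - y\<bar>) has_integral S * (1 - x)\<^sup>2 / 2) {x..1}"
  proof -
    have "((\<lambda>y. S * (y - x)) has_integral S * (1 - x)\<^sup>2 / 2 - S * (x - x)\<^sup>2 / 2) {x..1}"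
      using x by (intro fundamental_theorem_of_calculus)
        (auto simp: has_real_derivative_iff_has_vector_derivative[symmetric] intro!: derivative_eq_intros)
    then have "((\<lambda>y. S * (y - x)) has_integral S * (1 - x)\<^sup>2 / 2) {x..1}" by simp
    then show ?thesis by (rule has_integral_cong[THEN iffD1, rotated]) auto
  qed
  have i2: "((\<lambda>y. S * \<bar>x - y\<bar>) has_integral S * x\<^sup>2 / 2 + S * (1 - x)\<^sup>2 / 2) {0..1}"
    using has_integral_combine[OF _ _ l r] x by simp
  have "\<bar>bernoulli_fun n x\<bar> \<le> S * x\<^sup>2 / 2 + S * (1 - x)\<^sup>2 / 2"
    using has_integral_le[OF i1 i2] lip
      has_integral_le[OF has_integral_neg[OF i1] i2] by (force simp: abs_le_iff)
  also have "\<dots> = S / 2 * (x\<^sup>2 + (1 - x)\<^sup>2)" by (simp add: field_simps)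
  also have "\<dots> \<le> S / 2 * 1"
  proof (rule mult_left_mono)
    have "x * (1 - x) \<ge> 0" using x by simp
    then show "x\<^sup>2 + (1 - x)\<^sup>2 \<le> 1" by (simp add: power2_eq_square algebra_simps)
    have "\<bar>bernoulli_fun (n - 1) 0\<bar> \<le> S" using S[of 0] by simp
    then show "0 \<le> S / 2" by simp
  qed
  finally show ?thesis by simp
qed

lemma bernoulli_fun_1: "bernoulli_fun 1 x = x - 1 / 2"
  by (simp add: bernoulli_fun_def bernoulli_poly_def)

lemma bernoulli_fun_2: "bernoulli_fun 2 x = (x\<^sup>2 - x + 1 / 6) / 2"
  by (simp add: bernoulli_fun_def bernoulli_poly_def numeral_2_eq_2 field_simps)

text \<open>The quadratic case has maximum 1/12, and every further degree halves the bound.\<close>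

lemma abs_bernoulli_fun_le:
  assumes "x \<in> {0..1}"
  shows "\<bar>bernoulli_fun (n + 2) x\<bar> \<le> 1 / (12 * 2 ^ n)"
  using assms
proof (induction n arbitrary: x)
  case 0
  have "x * (1 - x) \<ge> 0" "(x - 1 / 2)\<^sup>2 \<ge> 0" using 0 by auto
  then have "x * x + 1 / 6 - x \<le> 1 / 6" "- (x * x + 1 / 6 - x) \<le> 1 / 6"
    by (simp_all add: power2_eq_square algebra_simps)
  then have "\<bar>x * x + 1 / 6 - x\<bar> \<le> 1 / 6" by (rule abs_leI)
  then show ?case
    by (simp only: add_0 bernoulli_fun_2) (simp add: power2_eq_square algebra_simps)
next
  case (Suc n)
  then show ?case
    using abs_bernoulli_fun_le_half[of "Suc n + 2" "1 / (12 * 2 ^ n)" x] by simp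
qed

section \<open>The univariate kernel and the mean of its diagonal\<close>

definition unit_kernel :: "nat \<Rightarrow> real \<Rightarrow> real \<Rightarrow> real" where
  "unit_kernel \<alpha> x y = (\<Sum>r=1..\<alpha>. bernoulli_fun r x * bernoulli_fun r y)
     + (-1) ^ (\<alpha> + 1) * bernoulli_fun (2 * \<alpha>) \<bar>x - y\<bar>"

lemma sobolev_kernel_eq:
  "sobolev_kernel s \<alpha> \<gamma> x y = (\<Sum>u\<in>Pow {1..s}. \<gamma> u * (\<Prod>j\<in>u. unit_kernel \<alpha> (x j) (y j)))"
  by (simp add: sobolev_kernel_def unit_kernel_def bernoulli_fun_def power2_eq_square)

lemma unit_kernel_commute: "unit_kernel \<alpha> x y = unit_kernel \<alpha> y x"
  by (simp add: unit_kernel_def mult.commute abs_minus_commute)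

lemma continuous_unit_kernel:
  "continuous_on S f \<Longrightarrow> continuous_on S g \<Longrightarrow> continuous_on S (\<lambda>z. unit_kernel \<alpha> (f z) (g z))"
  unfolding unit_kernel_def
  by (intro continuous_intros continuous_on_compose2[OF continuous_on_bernoulli_fun[of UNIV]]) auto

lemma unit_kernel_has_integral_0:
  assumes "1 \<le> \<alpha>" "x \<in> {0..1}"
  shows "(unit_kernel \<alpha> x has_integral 0) {0..1}"
proof -
  have "((\<lambda>y. (\<Sum>r=1..\<alpha>. bernoulli_fun r x * bernoulli_fun r y)
     + (-1) ^ (\<alpha> + 1) * bernoulli_fun (2 * \<alpha>) \<bar>x - y\<bar>) has_integral
     (\<Sum>r=1..\<alpha>. bernoulli_fun r x * 0) + (-1) ^ (\<alpha> + 1) * 0) {0..1}"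
    using assms
    by (intro has_integral_add has_integral_sum has_integral_mult_right bernoulli_fun_has_integral_0
        has_integral_bernoulli_fun_dist) auto
  then show ?thesis by (simp add: unit_kernel_def[abs_def])
qed

text \<open>The summand r = 1 is the square of x - 1/2 and has mean 1/12. Everything else on the
  diagonal is at most 1/36 in absolute value, and 1/12 + 1/36 = 1/9.\<close>

lemma unit_kernel_diag_integral:
  assumes "2 \<le> \<alpha>"
  shows "\<bar>integral {0..1} (\<lambda>x. unit_kernel \<alpha> x x)\<bar> \<le> 1 / 9"
proof -
  define R where "R x = unit_kernel \<alpha> x x - (x - 1 / 2)\<^sup>2" for x
  \<comment> \<open>For \<alpha> = 2 both sides agree, as 1/144 + 1/48 = 1/36. Raising \<alpha> by
    one adds less to the sum than the last summand loses.\<close>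
  have geo: "(\<Sum>r\<in>{2..\<alpha>}. 1 / (144 * 4 ^ (r - 2))) + 1 / (12 * 4 ^ (\<alpha> - 1)) \<le> (1 / 36 :: real)"
    using assms
  proof (induction \<alpha> rule: dec_induct)
    case (step n)
    obtain m where "n = Suc (Suc m)"
      using step(1) by (metis Suc_le_D numeral_2_eq_2 Suc_le_mono)
    then show ?case using step by (simp add: field_simps)
  qed simp
  have R: "\<bar>R x\<bar> \<le> 1 / 36" if "x \<in> {0..1}" for x
  proof -
    have "{1..\<alpha>} = insert 1 {2..\<alpha>}" using assms by auto
    then have "R x = (\<Sum>r\<in>{2..\<alpha>}. (bernoulli_fun r x)\<^sup>2) + (-1) ^ (\<alpha> + 1) * bernoulli_fun (2 * \<alpha>) 0"
      by (simp add: R_def unit_kernel_def bernoulli_fun_1[unfolded One_nat_def] power2_eq_square)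
    then have "\<bar>R x\<bar> \<le> (\<Sum>r\<in>{2..\<alpha>}. (bernoulli_fun r x)\<^sup>2) + \<bar>(-1) ^ (\<alpha> + 1) * bernoulli_fun (2 * \<alpha>) 0\<bar>"
      using abs_triangle_ineq[of "\<Sum>r\<in>{2..\<alpha>}. (bernoulli_fun r x)\<^sup>2" "(-1) ^ (\<alpha> + 1) * bernoulli_fun (2 * \<alpha>) 0"]
        sum_nonneg[of "{2..\<alpha>}" "\<lambda>r. (bernoulli_fun r x)\<^sup>2"] by simp
    also have "\<bar>(-1) ^ (\<alpha> + 1) * bernoulli_fun (2 * \<alpha>) 0\<bar> = \<bar>bernoulli_fun (2 * \<alpha> - 2 + 2) 0\<bar>"
    proof -
      have "2 * \<alpha> - 2 + 2 = 2 * \<alpha>" using assms by simp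
      then show ?thesis by (simp only: abs_mult power_abs abs_minus abs_one power_one mult_1)
    qed
    also have "\<dots> \<le> 1 / (12 * 2 ^ (2 * \<alpha> - 2))"
      by (rule abs_bernoulli_fun_le) simp
    also have "(2::real) ^ (2 * \<alpha> - 2) = 4 ^ (\<alpha> - 1)"
      using power_mult[of "2::real" 2 "\<alpha> - 1"] by (simp add: right_diff_distrib')
    also have "(\<Sum>r\<in>{2..\<alpha>}. (bernoulli_fun r x)\<^sup>2) \<le> (\<Sum>r\<in>{2..\<alpha>}. 1 / (144 * 4 ^ (r - 2)))"
    proof (rule sum_mono)
      fix r assume "r \<in> {2..\<alpha>}"
      then have "\<bar>bernoulli_fun r x\<bar> \<le> 1 / (12 * 2 ^ (r - 2))"
        using abs_bernoulli_fun_le[OF that, of "r - 2"] le_add_diff_inverse2[of 2 r] by simp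
      then have "\<bar>bernoulli_fun r x\<bar>\<^sup>2 \<le> (1 / (12 * 2 ^ (r - 2)))\<^sup>2" by (rule power_mono) simp
      also have "\<dots> = 1 / (144 * 4 ^ (r - 2))"
        by (simp add: power2_eq_square power_mult_distrib[symmetric])
      finally show "(bernoulli_fun r x)\<^sup>2 \<le> 1 / (144 * 4 ^ (r - 2))" by simp
    qed
    finally show ?thesis using geo by simp
  qed
  have i1: "((\<lambda>x::real. (x - 1 / 2)\<^sup>2) has_integral 1 / 12) {0..1}"
  proof -
    have "((\<lambda>x::real. (x - 1 / 2)\<^sup>2) has_integral (1 - 1 / 2) ^ 3 / 3 - (0 - 1 / 2) ^ 3 / 3) {0..1}"
      by (intro fundamental_theorem_of_calculus)
        (auto simp: has_real_derivative_iff_has_vector_derivative[symmetric] intro!: derivative_eq_intros)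
    then show ?thesis by (simp add: power3_eq_cube)
  qed
  have "continuous_on {0..1} (\<lambda>x. unit_kernel \<alpha> x x)"
    by (intro continuous_unit_kernel continuous_intros)
  then have k: "(\<lambda>x. unit_kernel \<alpha> x x) integrable_on {0..1}" by (rule integrable_continuous_real)
  have Ri: "R integrable_on {0..1}"
    unfolding R_def[abs_def] using integrable_diff[OF k has_integral_integrable[OF i1]] .
  have "\<bar>integral {0..1} R\<bar> \<le> integral {0..1} (\<lambda>_::real. 1 / 36)"
    using integral_norm_bound_integral[OF Ri, of "\<lambda>_. 1 / 36"] R by auto
  moreover have "integral {0..1} (\<lambda>x. unit_kernel \<alpha> x x) = integral {0..1} R + 1 / 12"
    using integral_add[OF Ri has_integral_integrable[OF i1]] integral_unique[OF i1]
    by (simp add: R_def)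
  ultimately show ?thesis by (simp add: abs_le_iff)
qed

lemma unit_kernel_bounded: "\<exists>C. \<forall>x\<in>{0..1}. \<forall>y\<in>{0..1}. \<bar>unit_kernel \<alpha> x y\<bar> \<le> C"
proof -
  have "continuous_on ({0..1} \<times> {0..1}) (\<lambda>z. unit_kernel \<alpha> (fst z) (snd z))"
    by (intro continuous_unit_kernel continuous_intros)
  from compact_continuous_image[OF this compact_Times[OF compact_Icc compact_Icc]]
  have "bounded ((\<lambda>z. unit_kernel \<alpha> (fst z) (snd z)) ` ({0..1} \<times> {0..1}))"
    by (rule compact_imp_bounded)
  then show ?thesis unfolding bounded_iff by fastforce
qed

section \<open>Lipschitz bounds for Bernoulli polynomials and products\<close>

lemma bernoulli_fun_lipschitz: "\<exists>L. L-lipschitz_on {0..1} (bernoulli_fun n)"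
proof (cases n)
  case 0
  then show ?thesis
    by (intro exI[of _ 0]) (simp add: lipschitz_on_def bernoulli_fun_def)
next
  case (Suc m)
  have "bounded (bernoulli_fun m ` {0..1})"
    using compact_continuous_image[OF continuous_on_bernoulli_fun compact_Icc] by (rule compact_imp_bounded)
  then obtain L where L: "\<And>y. y \<in> {0..1} \<Longrightarrow> \<bar>bernoulli_fun m y\<bar> \<le> L"
    unfolding bounded_iff by fastforce
  moreover have "0 \<le> L" using L[of 0] by simp
  ultimately show ?thesis
    using field_differentiable_bound[of "{0..1}" "bernoulli_fun n" "bernoulli_fun m" L]
      bernoulli_fun_has_derivative[of m] Suc
    by (intro exI[of _ L]) (auto simp: lipschitz_on_def dist_real_def)
qed

lemma lipschitz_on_mult_bounded:
  fixes f g :: "'a::metric_space \<Rightarrow> real"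
  assumes "L-lipschitz_on S f" "M-lipschitz_on S g" "\<And>x. x \<in> S \<Longrightarrow> \<bar>f x\<bar> \<le> A" "\<And>x. x \<in> S \<Longrightarrow> \<bar>g x\<bar> \<le> B"
    "0 \<le> A" "0 \<le> B"
  shows "(L * B + A * M)-lipschitz_on S (\<lambda>x. f x * g x)"
proof (rule lipschitz_onI)
  have L: "0 \<le> L" and M: "0 \<le> M" using assms(1,2) by (auto simp: lipschitz_on_def)
  then show "0 \<le> L * B + A * M" using assms by simp
  fix x y assume xy: "x \<in> S" "y \<in> S"
  have "f x * g x - f y * g y = (f x - f y) * g x + f y * (g x - g y)" by (simp add: algebra_simps)
  then have "\<bar>f x * g x - f y * g y\<bar> \<le> \<bar>f x - f y\<bar> * \<bar>g x\<bar> + \<bar>f y\<bar> * \<bar>g x - g y\<bar>"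
    by (metis abs_mult abs_triangle_ineq)
  also have "\<dots> \<le> (L * dist x y) * B + A * (M * dist x y)"
    using assms xy lipschitz_onD[OF assms(1) xy] lipschitz_onD[OF assms(2) xy] L M
    by (intro add_mono mult_mono) (auto simp: dist_real_def)
  finally show "dist (f x * g x) (f y * g y) \<le> (L * B + A * M) * dist x y"
    by (simp add: dist_real_def algebra_simps)
qed

section \<open>Digital shifts of the unit interval\<close>

definition unit_measure :: "real measure" where
  "unit_measure = restrict_space lborel {0..<1}"

lemma space_unit_measure [simp]: "space unit_measure = {0..<1}"
  by (simp add: unit_measure_def space_restrict_space)

lemma measurable_unit_measure [measurable (raw)]:
  "f \<in> borel_measurable borel \<Longrightarrow> f \<in> borel_measurable unit_measure"
  unfolding unit_measure_def by (rule measurable_restrict_space1) simp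

interpretation unit_measure: prob_space unit_measure
proof
  show "emeasure unit_measure (space unit_measure) = 1"
    unfolding unit_measure_def by (simp add: emeasure_restrict_space space_restrict_space)
qed

lemma integral_unit_measure:
  "integral\<^sup>L unit_measure f = (LINT x|lborel. indicator {0..<1} x * f x)" for f :: "real \<Rightarrow> real"
  unfolding unit_measure_def by (subst integral_restrict_space) auto

lemma integrable_unit_measure:
  fixes f :: "real \<Rightarrow> real"
  assumes "f \<in> borel_measurable borel" "\<And>x. x \<in> {0..1} \<Longrightarrow> \<bar>f x\<bar> \<le> B"
  shows "integrable unit_measure f"
  using assms by (intro unit_measure.integrable_const_bound[where B = B] AE_I2) (auto simp: measurable_unit_measure)

lemma integral_unit_measure_eq:
  fixes f :: "real \<Rightarrow> real"
  assumes "continuous_on UNIV f" "(f has_integral I) {0..1}"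
  shows "integral\<^sup>L unit_measure f = I"
proof -
  have "set_integrable lborel {0..1} f"
    using borel_integrable_compact[of "{0..1}" f] assms(1) continuous_on_subset[OF assms(1) subset_UNIV]
    by (simp add: set_integrable_def)
  then have "(LINT x:{0..1}|lborel. f x) = I"
    using set_borel_integral_eq_integral(2)[of "{0..1}" f] assms(2) by (simp add: integral_unique)
  moreover have "AE x in lborel. indicator {0..<1} x * f x = indicator {0..1} x *\<^sub>R f x"
    using AE_lborel_singleton[of 1] by eventually_elim (auto simp: indicator_def)
  ultimately show ?thesis
    unfolding integral_unit_measure set_lebesgue_integral_def
    by (subst integral_cong_AE[where g = "\<lambda>x. indicator {0..1} x *\<^sub>R f x"])
      (use borel_measurable_continuous_onI[OF assms(1)] in auto)
qed

lemma abs_integral_unit_measure_le: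
  fixes f :: "real \<Rightarrow> real"
  assumes "f \<in> borel_measurable borel" "\<And>x. x \<in> {0..1} \<Longrightarrow> \<bar>f x\<bar> \<le> B"
  shows "\<bar>integral\<^sup>L unit_measure f\<bar> \<le> B"
proof -
  have i: "integrable unit_measure f" by (rule integrable_unit_measure[OF assms]) auto
  have "\<bar>integral\<^sup>L unit_measure f\<bar> \<le> (LINT x|unit_measure. \<bar>f x\<bar>)" by (rule integral_abs_bound)
  also have "\<dots> \<le> (LINT x|unit_measure. B)"
    using i assms(2) by (intro integral_mono) auto
  also have "\<dots> = B" using unit_measure.prob_space by simp
  finally show ?thesis .
qed

text \<open>Cut the interval into the cells on which the first b-adic digit is constant, and stretch
  each cell to the whole interval. This prepares the induction over digits.\<close>

lemma integral_unit_measure_split: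
  fixes f :: "real \<Rightarrow> real"
  assumes b: "1 \<le> b" and f: "f \<in> borel_measurable borel" "\<And>x. x \<in> {0..1} \<Longrightarrow> \<bar>f x\<bar> \<le> B"
  shows "integral\<^sup>L unit_measure f
    = (\<Sum>k<b. LINT t|unit_measure. f ((real k + t) / real b)) / real b"
proof -
  have ind: "indicator {0..<1} x = (\<Sum>k<b. indicator {real k / real b..<(real k + 1) / real b} x :: real)" for x :: real
  proof (cases "x \<in> {0..<1}")
    case True
    define k where "k = nat \<lfloor>x * real b\<rfloor>"
    have k: "real k \<le> x * real b" "x * real b < real k + 1" using True by (simp_all add: k_def)
    have "x * real b < real b" using True b by simp
    with k have "k < b" by linarith
    have "x \<in> {real j / real b..<(real j + 1) / real b} \<longleftrightarrow> j = k" for j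
    proof -
      have "x \<in> {real j / real b..<(real j + 1) / real b} \<longleftrightarrow> real j \<le> x * real b \<and> x * real b < real j + 1"
        using b by (simp add: field_simps)
      then show ?thesis using k by (auto simp: le_less_trans)
    qed
    then have "(\<Sum>j<b. indicator {real j / real b..<(real j + 1) / real b} x :: real) = (\<Sum>j<b. if j = k then 1 else 0)"
      by (intro sum.cong) (auto simp: indicator_def)
    then show ?thesis using True \<open>k < b\<close> by simp
  next
    case False
    have "x \<notin> {real j / real b..<(real j + 1) / real b}" if "j < b" for j
    proof
      assume "x \<in> {real j / real b..<(real j + 1) / real b}"
      then have "real j \<le> x * real b" "x * real b < real j + 1" using b by (simp_all add: field_simps)
      moreover have "real j + 1 \<le> real b" using that by simp
      ultimately have "0 \<le> x * real b" "x * real b < 1 * real b" by linarith+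
      then have "x \<in> {0..<1}" using b by (auto simp: zero_le_mult_iff)
      with False show False by simp
    qed
    then show ?thesis using False by simp
  qed
  have cell: "indicator {real k / real b..<(real k + 1) / real b} (real k / real b + 1 / real b * x) = (indicator {0..<1} x :: real)" for k x
    using b by (auto simp: indicator_def field_simps)
  have "integrable unit_measure f" by (rule integrable_unit_measure[OF f]) auto
  then have i0: "integrable lborel (\<lambda>x. indicator {0..<1} x * f x)"
    by (simp add: unit_measure_def integrable_restrict_space)
  have i: "integrable lborel (\<lambda>x. indicator {real k / real b..<(real k + 1) / real b} x * f x)" if "k < b" for k
  proof (rule Bochner_Integration.integrable_bound[OF i0])
    show "AE x in lborel. norm (indicator {real k / real b..<(real k + 1) / real b} x * f x) \<le> norm (indicator {0..<1} x * f x)"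
    proof (rule AE_I2)
      fix x :: real
      have "(real k + 1) / real b \<le> 1" "0 \<le> real k / real b"
        using that b by (simp_all add: field_simps)
      then have "0 \<le> x \<and> x < 1" if "x \<in> {real k / real b..<(real k + 1) / real b}"
        using that unfolding atLeastLessThan_iff by linarith
      then show "norm (indicator {real k / real b..<(real k + 1) / real b} x * f x) \<le> norm (indicator {0..<1} x * f x)"
        by (auto simp: indicator_def)
    qed
  qed (use f in measurable)
  have "integral\<^sup>L unit_measure f = (LINT x|lborel. (\<Sum>k<b. indicator {real k / real b..<(real k + 1) / real b} x * f x))"
    unfolding integral_unit_measure ind by (simp add: sum_distrib_right)
  also have "\<dots> = (\<Sum>k<b. LINT x|lborel. indicator {real k / real b..<(real k + 1) / real b} x * f x)"
    using i by (intro Bochner_Integration.integral_sum) auto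
  also have "\<dots> = (\<Sum>k<b. (LINT t|unit_measure. f ((real k + t) / real b)) / real b)"
  proof (rule sum.cong[OF refl])
    fix k
    show "(LINT x|lborel. indicator {real k / real b..<(real k + 1) / real b} x * f x)
        = (LINT t|unit_measure. f ((real k + t) / real b)) / real b"
      using b by (subst lborel_integral_real_affine[where c = "1 / real b" and t = "real k / real b"])
        (simp_all only: cell integral_unit_measure, simp_all add: add_divide_distrib)
  qed
  finally show ?thesis by (simp add: sum_divide_distrib)
qed

lemma measurable_digit [measurable]:
  "(\<lambda>x. digit b x i) \<in> measurable borel (count_space UNIV)"
  unfolding digit_def by measurable

lemma borel_measurable_digit_add [measurable (raw)]:
  assumes [measurable]: "f \<in> borel_measurable M" "g \<in> borel_measurable M"
  shows "(\<lambda>x. digit_add b (f x) (g x)) \<in> borel_measurable M"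
proof -
  have "(\<lambda>x. real_of_int ((digit b (f x) (Suc i) + digit b (g x) (Suc i)) mod int b)) \<in> borel_measurable M" for i
    by (intro measurable_compose_countable[where f = "\<lambda>k x. real_of_int ((k + digit b (g x) (Suc i)) mod int b)"
          and g = "\<lambda>x. digit b (f x) (Suc i)"]
        measurable_compose_countable[where f = "\<lambda>l x. real_of_int ((k + l) mod int b)"
          and g = "\<lambda>x. digit b (g x) (Suc i)" for k]) simp_all
  then show ?thesis
    unfolding digit_add_def by (intro borel_measurable_suminf borel_measurable_divide) auto
qed

lemma digit_add_commute: "digit_add b x y = digit_add b y x"
  by (simp add: digit_add_def add.commute)

section \<open>Range and self-similarity of digitwise addition\<close>

context
  fixes b :: nat
  assumes b: "2 \<le> b"
begin

lemma digit_add_term_le: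
  "real_of_int ((k + l) mod int b) / real b ^ Suc i \<le> (real b - 1) / real b * (1 / real b) ^ i"
proof -
  have "(k + l) mod int b \<le> int b - 1" using b pos_mod_bound[of "int b" "k + l"] by simp
  then have "real_of_int ((k + l) mod int b) \<le> real b - 1" by linarith
  then show ?thesis using b by (simp add: field_simps)
qed

lemma digit_add_term_nonneg: "0 \<le> real_of_int ((k + l) mod int b) / real b ^ i"
  using b by simp

lemma sums_digit_bound: "(\<lambda>i. (real b - 1) / real b * (1 / real b) ^ i) sums 1"
proof -
  have "(\<lambda>i. (real b - 1) / real b * (1 / real b) ^ i) sums ((real b - 1) / real b * (1 / (1 - 1 / real b)))"
    using b by (intro sums_mult geometric_sums) simp
  also have "(real b - 1) / real b * (1 / (1 - 1 / real b)) = 1"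
    using b by (simp add: field_simps)
  finally show ?thesis .
qed

lemma summable_digit_add:
  "summable (\<lambda>i. real_of_int ((digit b x (Suc i) + digit b y (Suc i)) mod int b) / real b ^ Suc i)"
  by (rule summable_comparison_test'[OF sums_summable[OF sums_digit_bound], of 0])
    (simp only: real_norm_def abs_of_nonneg[OF digit_add_term_nonneg] digit_add_term_le)

lemma digit_add_bounds: "digit_add b x y \<in> {0..1}"
proof -
  have "digit_add b x y \<ge> 0"
    unfolding digit_add_def by (intro suminf_nonneg summable_digit_add digit_add_term_nonneg)
  moreover have "digit_add b x y \<le> (\<Sum>i. (real b - 1) / real b * (1 / real b) ^ i)"
    unfolding digit_add_def
    by (intro suminf_le summable_digit_add digit_add_term_le sums_summable[OF sums_digit_bound])
  ultimately show ?thesis using sums_unique[OF sums_digit_bound] by simp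
qed

lemma digit_Suc_divide: "digit b ((real k + t) / real b) (Suc (Suc i)) = digit b t (Suc i)"
proof -
  have "(real k + t) / real b * real b ^ Suc (Suc i) = real_of_int (int (k * b ^ i) * int b) + t * real b ^ Suc i"
    using b by (simp add: field_simps)
  then show ?thesis unfolding digit_def by (simp only: floor_add_int[symmetric] mod_mult_self3 add.commute) simp
qed

lemma digit_1_divide:
  assumes "k < b" "t \<in> {0..<1}"
  shows "digit b ((real k + t) / real b) (Suc 0) = int k"
proof -
  have "\<lfloor>real k + t\<rfloor> = int k" using assms by (intro floor_unique) auto
  then show ?thesis using b assms by (simp add: digit_def)
qed

text \<open>Splitting off the leading digit: it is rotated by the leading digit of x, and the later
  digits are added as if the leading ones had been deleted.\<close>

lemma digit_add_divide:
  assumes "k < b" "t \<in> {0..<1}"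
  shows "digit_add b x ((real k + t) / real b)
    = (real ((nat (digit b x 1) + k) mod b) + digit_add b (real b * x) t) / real b"
proof -
  let ?y = "(real k + t) / real b"
  let ?f = "\<lambda>x y i. real_of_int ((digit b x (Suc i) + digit b y (Suc i)) mod int b) / real b ^ Suc i"
  \<comment> \<open>The number \<open>real b * x\<close> may lie outside the unit interval. Its
    integer part is invisible to digits after the point, since these are taken modulo b, so no
    fractional part is formed.\<close>
  have shift: "digit b (real b * x) (Suc i) = digit b x (Suc (Suc i))" for i
    by (simp add: digit_def mult_ac)
  have "digit b x 1 \<ge> 0" using b by (simp add: digit_def)
  then have 0: "?f x ?y 0 = real ((nat (digit b x 1) + k) mod b) / real b"
    using assms digit_1_divide[OF assms] by (simp add: zmod_int of_int_of_nat_eq[symmetric, where 'a=real] del: of_int_of_nat_eq)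
  have "digit_add b x ?y = ?f x ?y 0 + (\<Sum>i. ?f x ?y (Suc i))"
    using suminf_split_head[OF summable_digit_add[of x ?y]] by (simp add: digit_add_def)
  also have "(\<lambda>i. ?f x ?y (Suc i)) = (\<lambda>i. ?f (real b * x) t i / real b)"
    by (simp only: digit_Suc_divide shift) (simp add: mult_ac)
  also have "(\<Sum>i. ?f (real b * x) t i / real b) = digit_add b (real b * x) t / real b"
    unfolding digit_add_def by (rule suminf_divide[OF summable_digit_add])
  finally show ?thesis unfolding 0 by (simp add: add_divide_distrib)
qed

text \<open>
  Up to the factor \<open>1 / b\<close>, the digital shift acts on each of the \<open>b\<close> subintervals as a digital shift
  acts on the unit interval, so that each application of this self-similarity shrinks the possible
  error by \<open>1 / b\<close>.
\<close>

lemma integral_digit_add_approx: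
  fixes f :: "real \<Rightarrow> real"
  assumes "L-lipschitz_on {0..1} f" "f \<in> borel_measurable borel"
  shows "\<bar>(LINT t|unit_measure. f (digit_add b x t)) - integral\<^sup>L unit_measure f\<bar> \<le> L / real b ^ m"
  using assms
proof (induction m arbitrary: f x L)
  have bdd: "\<bar>f t\<bar> \<le> \<bar>f 0\<bar> + L" if "L-lipschitz_on {0..1} f" "t \<in> {0..1}" for f :: "real \<Rightarrow> real" and L t
  proof -
    have "\<bar>f t - f 0\<bar> \<le> L * \<bar>t - 0\<bar>"
      using lipschitz_onD[OF that(1) that(2), of 0] by (simp add: dist_real_def)
    also have "\<dots> \<le> L * 1"
      using that by (intro mult_left_mono) (auto simp: lipschitz_on_def)
    finally show ?thesis by linarith
  qed
  {
    case 0
    note [measurable] = 0(2)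
    have int: "integrable unit_measure f" "integrable unit_measure (\<lambda>t. f (digit_add b x t))"
      using bdd[OF 0(1)] digit_add_bounds
      by (auto intro!: integrable_unit_measure[where B = "\<bar>f 0\<bar> + L"])
    have "\<bar>LINT t|unit_measure. f (digit_add b x t) - f t\<bar> \<le> L"
    proof (rule abs_integral_unit_measure_le)
      fix t :: real assume t: "t \<in> {0..1}"
      have "\<bar>f (digit_add b x t) - f t\<bar> \<le> L * \<bar>digit_add b x t - t\<bar>"
        using lipschitz_onD[OF 0(1) digit_add_bounds t] by (simp add: dist_real_def)
      also have "\<dots> \<le> L * 1"
        using 0(1) t digit_add_bounds[of x t] by (intro mult_left_mono) (auto simp: lipschitz_on_def)
      finally show "\<bar>f (digit_add b x t) - f t\<bar> \<le> L" by simp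
    qed measurable
    then show ?case using int by simp
  next
    case (Suc m)
    note [measurable] = Suc(3)
    define g where "g k t = f ((real k + t) / real b)" for k t
    have [measurable]: "g k \<in> borel_measurable borel" for k
      unfolding g_def by measurable
    have sub: "(real k + t) / real b \<in> {0..1}" if "k < b" "t \<in> {0..1}" for k t
    proof -
      have "real k + 1 \<le> real b" using that by simp
      then show ?thesis using that by (simp add: field_simps)
    qed
    have lip: "(L / real b)-lipschitz_on {0..1} (g k)" if "k < b" for k
    proof (rule lipschitz_onI)
      show "0 \<le> L / real b" using Suc(2) by (simp add: lipschitz_on_def)
      fix t u :: real assume tu: "t \<in> {0..1}" "u \<in> {0..1}"
      have "dist (g k t) (g k u) \<le> L * dist ((real k + t) / real b) ((real k + u) / real b)"
        unfolding g_def using lipschitz_onD[OF Suc(2) sub[OF that tu(1)] sub[OF that tu(2)]] .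
      also have "dist ((real k + t) / real b) ((real k + u) / real b) = dist t u / real b"
        using b by (simp add: dist_real_def diff_divide_distrib[symmetric])
      finally show "dist (g k t) (g k u) \<le> L / real b * dist t u" by simp
    qed
    define a where "a = nat (digit b x 1)"
    have "a < b" using b by (simp add: a_def digit_def nat_less_iff)
    define J where "J k = (LINT t|unit_measure. g k (digit_add b (real b * x) t))" for k
    have "(LINT t|unit_measure. f (digit_add b x t))
        = (\<Sum>k<b. LINT t|unit_measure. f (digit_add b x ((real k + t) / real b))) / real b"
      using b bdd[OF Suc(2)] digit_add_bounds
      by (intro integral_unit_measure_split[where B = "\<bar>f 0\<bar> + L"]) auto
    also have "(\<Sum>k<b. LINT t|unit_measure. f (digit_add b x ((real k + t) / real b))) = (\<Sum>k<b. J ((a + k) mod b))"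
      unfolding J_def g_def a_def
      by (intro sum.cong refl Bochner_Integration.integral_cong) (auto simp: digit_add_divide)
    \<comment> \<open>The leading digit \<open>a\<close> of x rotates the cells cyclically, and
      adding \<open>b - a\<close> undoes the rotation, so the sum is merely reindexed.\<close>
    also have "\<dots> = (\<Sum>k<b. J k)"
    proof -
      have "((a + k) mod b + (b - a)) mod b = k" "(a + (k + (b - a)) mod b) mod b = k" if "k < b" for k
      proof -
        have "a + k + (b - a) = k + b" "a + (k + (b - a)) = k + b" using \<open>a < b\<close> by simp_all
        then show "((a + k) mod b + (b - a)) mod b = k" "(a + (k + (b - a)) mod b) mod b = k"
          unfolding mod_add_left_eq mod_add_right_eq using that by simp_all
      qed
      then show ?thesis
        using b by (intro sum.reindex_bij_witness[where j = "\<lambda>k. (a + k) mod b" and i = "\<lambda>k. (k + (b - a)) mod b"]) auto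
    qed
    finally have 1: "(LINT t|unit_measure. f (digit_add b x t)) = (\<Sum>k<b. J k) / real b" .
    have 2: "integral\<^sup>L unit_measure f = (\<Sum>k<b. integral\<^sup>L unit_measure (g k)) / real b"
      unfolding g_def using b bdd[OF Suc(2)]
      by (intro integral_unit_measure_split[where B = "\<bar>f 0\<bar> + L"]) auto
    have "\<bar>(\<Sum>k<b. J k) - (\<Sum>k<b. integral\<^sup>L unit_measure (g k))\<bar>
        \<le> (\<Sum>k<b. \<bar>J k - integral\<^sup>L unit_measure (g k)\<bar>)"
      unfolding sum_subtractf[symmetric] by (rule sum_abs)
    also have "\<dots> \<le> (\<Sum>k<b. (L / real b) / real b ^ m)"
      unfolding J_def using Suc.IH[OF lip] by (intro sum_mono) auto
    also have "\<dots> = real b * (L / real b ^ Suc m)" by simp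
    finally show ?case
      unfolding 1 2 diff_divide_distrib[symmetric] using b by (simp add: abs_divide field_simps)
  }
qed

text \<open>The number of digits in the approximation tends to infinity. Lipschitz integrands are
  all that is needed later: they include the sections and the diagonal of the kernel, and they
  approximate the indicator of a point.\<close>

lemma integral_digit_add:
  fixes f :: "real \<Rightarrow> real"
  assumes "L-lipschitz_on {0..1} f" "f \<in> borel_measurable borel"
  shows "(LINT t|unit_measure. f (digit_add b x t)) = integral\<^sup>L unit_measure f"
proof -
  have "(\<lambda>m. L / real b ^ m) \<longlonglongrightarrow> 0"
    using b by (intro LIMSEQ_divide_realpow_zero) auto
  then have "\<bar>(LINT t|unit_measure. f (digit_add b x t)) - integral\<^sup>L unit_measure f\<bar> \<le> 0"
    using integral_digit_add_approx[OF assms] by (intro LIMSEQ_le_const) auto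
  then show ?thesis by simp
qed

text \<open>A sum with value 1 would leave the half-open interval. Lipschitz functions concentrated
  near 1 have small integral, which the shift preserves, and so they bound the measure of the
  offending shifts.\<close>

lemma AE_digit_add_less_1: "AE t in unit_measure. digit_add b x t < 1"
proof -
  define S where "S = {t \<in> space unit_measure. digit_add b x t = 1}"
  have S: "S \<in> sets unit_measure" unfolding S_def by measurable
  have "unit_measure.prob S \<le> inverse (real (Suc n))" for n
  proof -
    \<comment> \<open>A ramp of slope n + 1 reaching 1 at t = 1. Composed with the shift it
      dominates the indicator of \<open>S\<close>; by itself it lives on an interval of length 1 /
      (n + 1).\<close>
    define f where "f t = max 0 (1 - real (Suc n) * (1 - t))" for t
    have [measurable]: "f \<in> borel_measurable borel" unfolding f_def by measurable
    have lip: "(real (Suc n))-lipschitz_on {0..1} f"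
    proof (rule lipschitz_onI)
      fix t u :: real
      have "dist (f t) (f u) \<le> \<bar>real (Suc n) * t - real (Suc n) * u\<bar>"
        unfolding f_def dist_real_def by (auto simp: max_def right_diff_distrib)
      then show "dist (f t) (f u) \<le> real (Suc n) * dist t u"
        by (simp add: dist_real_def abs_mult right_diff_distrib[symmetric] del: of_nat_Suc)
    qed simp
    have f01: "\<bar>f t\<bar> \<le> 1" if "t \<in> {0..1}" for t
      using that by (auto simp: f_def max_def zero_le_mult_iff)
    have "unit_measure.prob S = (LINT t|unit_measure. indicator S t)"
      using sets.Int_space_eq2[OF S] by simp
    also have "\<dots> \<le> (LINT t|unit_measure. f (digit_add b x t))"
      using S f01 digit_add_bounds
      by (intro integral_mono integrable_unit_measure[where B = 1]) (auto simp: indicator_def S_def f_def)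
    also have "\<dots> = integral\<^sup>L unit_measure f"
      by (rule integral_digit_add[OF lip]) measurable
    also have "\<dots> \<le> (LINT t|unit_measure. indicator {1 - inverse (real (Suc n))..<1} t)"
    proof (intro integral_mono integrable_unit_measure[where B = 1] f01)
      fix t assume t: "t \<in> space unit_measure"
      then have "0 \<le> real (Suc n) * (1 - t)" by simp
      with t show "f t \<le> indicator {1 - inverse (real (Suc n))..<1} t"
        by (auto simp: f_def indicator_def max_def field_simps)
    qed (auto simp: indicator_def)
    also have "\<dots> = measure lborel {1 - inverse (real (Suc n))..<1}"
    proof -
      have "inverse (real (Suc n)) \<le> 1" by (simp add: field_simps)
      then have "indicator {0..<1} t * indicator {1 - inverse (real (Suc n))..<1} t
          = (indicator {1 - inverse (real (Suc n))..<1} t :: real)" for t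
        by (auto simp: indicator_def)
      then show ?thesis unfolding integral_unit_measure by (simp only:) simp
    qed
    also have "\<dots> = inverse (real (Suc n))" by simp
    finally show ?thesis .
  qed
  then have "unit_measure.prob S \<le> 0"
    using LIMSEQ_inverse_real_of_nat by (intro LIMSEQ_le_const) auto
  then have "unit_measure.prob S = 0" using measure_nonneg[of unit_measure S] by linarith
  then have "AE t in unit_measure. t \<notin> S"
    using S by (subst (asm) unit_measure.prob_eq_0) auto
  with AE_space show ?thesis
  proof eventually_elim
    case (elim t)
    then show ?case using digit_add_bounds[of x t] by (auto simp: S_def)
  qed
qed

end

section \<open>Quadrature in reproducing kernel Hilbert spaces\<close>

context rkhs
begin

text \<open>The representer of a linear combination of point evaluations. Using an index set instead
  of a set of points allows repeated points, as in a multiset.\<close>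

definition kernel_comb :: "'i set \<Rightarrow> ('i \<Rightarrow> real) \<Rightarrow> ('i \<Rightarrow> 'p) \<Rightarrow> 'p \<Rightarrow> real" where
  "kernel_comb I c p = (\<lambda>x. \<Sum>i\<in>I. c i * (if x \<in> X then K x (p i) else 0))"

lemma kernel_comb_mem:
  assumes "finite I" "\<And>i. i \<in> I \<Longrightarrow> p i \<in> X"
  shows "kernel_comb I c p \<in> H"
  using assms
proof (induction I)
  case empty
  then show ?case using zero_mem by (simp add: kernel_comb_def)
next
  case (insert i I)
  then show ?case
    using add_mem[OF scale_mem[OF kernel_mem[of "p i"], of "c i"], of "kernel_comb I c p"]
    by (simp add: kernel_comb_def)
qed

lemma ip_zero: "f \<in> H \<Longrightarrow> ip f (\<lambda>x. 0) = 0"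
  using ip_scale[OF zero_mem, of f 0] ip_sym[OF zero_mem, of f] by simp

lemma ip_kernel_comb:
  assumes "f \<in> H" "finite I" "\<And>i. i \<in> I \<Longrightarrow> p i \<in> X"
  shows "ip f (kernel_comb I c p) = (\<Sum>i\<in>I. c i * f (p i))"
  using assms(2,3)
proof (induction I)
  case empty
  then show ?case using ip_zero[OF assms(1)] by (simp add: kernel_comb_def)
next
  case (insert i I)
  let ?k = "\<lambda>x. if x \<in> X then K x (p i) else 0"
  have mem: "?k \<in> H" "(\<lambda>x. c i * ?k x) \<in> H" "kernel_comb I c p \<in> H"
    using insert by (auto intro!: kernel_mem scale_mem[of ?k] kernel_comb_mem)
  have "kernel_comb (insert i I) c p = (\<lambda>x. c i * ?k x + kernel_comb I c p x)"
    using insert by (simp add: kernel_comb_def)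
  then have "ip f (kernel_comb (insert i I) c p) = ip (\<lambda>x. c i * ?k x) f + ip (kernel_comb I c p) f"
    using ip_sym[OF assms(1) add_mem[OF mem(2,3)]] ip_add[OF mem(2,3) assms(1)] by simp
  also have "ip (\<lambda>x. c i * ?k x) f = c i * f (p i)"
    using ip_scale[OF mem(1) assms(1)] ip_sym[OF mem(1) assms(1)] reproducing[OF assms(1)] insert by simp
  also have "ip (kernel_comb I c p) f = (\<Sum>i\<in>I. c i * f (p i))"
    using insert ip_sym[OF assms(1) mem(3)] by simp
  finally show ?case using insert by simp
qed

lemma ip_diff_diff:
  assumes "f \<in> H" "g \<in> H"
  shows "ip (\<lambda>x. f x - t * g x) (\<lambda>x. f x - t * g x) = ip f f - 2 * t * ip f g + t\<^sup>2 * ip g g"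
proof -
  let ?g = "\<lambda>x. (- t) * g x"
  have g: "?g \<in> H" by (rule scale_mem[OF assms(2)])
  have fg: "(\<lambda>x. f x - t * g x) = (\<lambda>x. f x + ?g x)" by simp
  have "ip (\<lambda>x. f x + ?g x) (\<lambda>x. f x + ?g x) = ip f (\<lambda>x. f x + ?g x) + ip ?g (\<lambda>x. f x + ?g x)"
    using assms g by (intro ip_add add_mem)
  also have "ip f (\<lambda>x. f x + ?g x) = ip f f + ip ?g f"
    using ip_add[OF assms(1) g assms(1)] ip_sym[OF assms(1) add_mem[OF assms(1) g]] by simp
  also have "ip ?g (\<lambda>x. f x + ?g x) = ip f ?g + ip ?g ?g"
    using ip_add[OF assms(1) g g] ip_sym[OF g add_mem[OF assms(1) g]] by simp
  also have "ip f ?g = ip ?g f" by (rule ip_sym[OF assms(1) g])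
  also have "ip ?g f = - t * ip f g"
    using ip_scale[OF assms(2,1), of "- t"] ip_sym[OF assms] by simp
  also have "ip ?g ?g = (- t) * ((- t) * ip g g)"
    using ip_scale[OF assms(2) g, of "- t"] ip_scale[OF assms(2,2), of "- t"] ip_sym[OF assms(2) g] by simp
  finally show ?thesis unfolding fg by (simp add: power2_eq_square)
qed

lemma ip_Cauchy_Schwarz:
  assumes "f \<in> H" "g \<in> H"
  shows "(ip f g)\<^sup>2 \<le> ip f f * ip g g"
proof (cases "ip g g = 0")
  case True
  then show ?thesis using ip_definite[OF assms(2)] ip_zero[OF assms(1)] by simp
next
  case False
  then have pos: "0 < ip g g" using ip_nonneg[OF assms(2)] by linarith
  define t where "t = ip f g / ip g g"
  have "(\<lambda>x. f x - t * g x) \<in> H"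
    using add_mem[OF assms(1) scale_mem[OF assms(2), of "- t"]] by simp
  from ip_nonneg[OF this] have "0 \<le> ip f f - 2 * t * ip f g + t\<^sup>2 * ip g g"
    unfolding ip_diff_diff[OF assms] .
  then show ?thesis using pos by (simp add: t_def power2_eq_square field_simps)
qed

lemma kernel_commute: "x \<in> X \<Longrightarrow> y \<in> X \<Longrightarrow> K x y = K y x"
  using reproducing[OF kernel_mem, of x y] reproducing[OF kernel_mem, of y x] ip_sym[OF kernel_mem kernel_mem, of x y]
  by simp

text \<open>Cauchy-Schwarz with the difference of two kernel sections, whose squared norm is the
  factor in brackets. It carries continuity from the kernel to every member of
  \<open>H\<close>.\<close>

lemma eval_diff_le:
  assumes "f \<in> H" "x \<in> X" "y \<in> X"
  shows "(f x - f y)\<^sup>2 \<le> ip f f * (K x x - 2 * K x y + K y y)"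
proof -
  \<comment> \<open>Boolean indices keep the two terms apart even when x = y.\<close>
  define h where "h = kernel_comb {True, False} (\<lambda>i. if i then 1 else - 1) (\<lambda>i. if i then x else y)"
  have h: "h \<in> H" unfolding h_def using assms by (intro kernel_comb_mem) auto
  have ip_h: "ip f' h = f' x - f' y" if "f' \<in> H" for f'
    unfolding h_def using assms that by (subst ip_kernel_comb) auto
  have "h z = K z x - K z y" if "z \<in> X" for z
    using that by (simp add: h_def kernel_comb_def)
  then have "ip h h = K x x - 2 * K x y + K y y"
    using ip_h[OF h] assms kernel_commute[OF assms(2,3)] by simp
  then show ?thesis
    using ip_Cauchy_Schwarz[OF assms(1) h] ip_h[OF assms(1)] by simp
qed

lemma eval_le:
  assumes "f \<in> H" "x \<in> X"
  shows "(f x)\<^sup>2 \<le> ip f f * K x x"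
  using ip_Cauchy_Schwarz[OF assms(1) kernel_mem[OF assms(2)]] assms reproducing[OF _ assms(2)] kernel_mem[OF assms(2)]
  by simp

end

text \<open>
  The simple functions \<open>g n\<close> turn integration into limits of finite linear combinations of point
  evaluations, whose representers are combinations of kernel functions.
\<close>

locale rkhs_prob = rkhs X K H ip + prob_space M
  for X :: "'p set" and K H ip and M :: "'p measure" +
  fixes g :: "nat \<Rightarrow> 'p \<Rightarrow> 'p" and C m :: real
  assumes space_M: "space M = X"
    and g_mem: "x \<in> X \<Longrightarrow> g n x \<in> X"
    and finite_range: "finite (g n ` X)"
    and g_sets: "{x \<in> X. g n x = p} \<in> sets M"
    and K_bound: "x \<in> X \<Longrightarrow> y \<in> X \<Longrightarrow> \<bar>K x y\<bar> \<le> C"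
    and K_lim: "x \<in> X \<Longrightarrow> y \<in> X \<Longrightarrow> (\<lambda>n. K (g n x) (g n y)) \<longlonglongrightarrow> K x y"
    and K_lim1: "x \<in> X \<Longrightarrow> y \<in> X \<Longrightarrow> (\<lambda>n. K (g n x) y) \<longlonglongrightarrow> K x y"
    and K_integral: "x \<in> X \<Longrightarrow> (LINT y|M. K x y) = m"
begin

definition weight :: "nat \<Rightarrow> 'p \<Rightarrow> real" where
  "weight n p = prob {x \<in> X. g n x = p}"

lemma
  fixes h :: "'p \<Rightarrow> real"
  shows integrable_simple: "integrable M (\<lambda>x. h (g n x))"
    and integral_simple: "(LINT x|M. h (g n x)) = (\<Sum>p\<in>g n ` X. weight n p * h p)"
proof -
  have eq: "h (g n x) = (\<Sum>p\<in>g n ` X. indicator {x \<in> X. g n x = p} x * h p)" if "x \<in> space M" for x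
  proof -
    have "(\<Sum>p\<in>g n ` X. indicator {x \<in> X. g n x = p} x * h p) = (\<Sum>p\<in>g n ` X. if p = g n x then h p else 0)"
      using that by (intro sum.cong) (auto simp: indicator_def space_M)
    then show ?thesis using that finite_range[of n] by (simp add: space_M)
  qed
  have int: "integrable M (\<lambda>x. indicator {x \<in> X. g n x = p} x * h p)" for p
    using g_sets[of n p] by (intro integrable_mult_left integrable_real_indicator) (auto simp: emeasure_eq_measure)
  show "integrable M (\<lambda>x. h (g n x))"
    using int by (subst Bochner_Integration.integrable_cong[OF refl eq]) auto
  have "(LINT x|M. h (g n x)) = (LINT x|M. (\<Sum>p\<in>g n ` X. indicator {x \<in> X. g n x = p} x * h p))"
    by (rule Bochner_Integration.integral_cong[OF refl eq])
  also have "\<dots> = (\<Sum>p\<in>g n ` X. LINT x|M. indicator {x \<in> X. g n x = p} x * h p)"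
    using int by (rule Bochner_Integration.integral_sum)
  also have "\<dots> = (\<Sum>p\<in>g n ` X. weight n p * h p)"
    using g_sets sets.Int_space_eq2[OF g_sets] by (simp add: weight_def)
  finally show "(LINT x|M. h (g n x)) = (\<Sum>p\<in>g n ` X. weight n p * h p)" .
qed

lemma C_nonneg: "0 \<le> C"
proof -
  obtain x where "x \<in> X" using not_empty space_M by auto
  then show ?thesis using K_bound[of x x] by linarith
qed

lemma mem_bound:
  assumes "f \<in> H" "x \<in> X"
  shows "\<bar>f x\<bar> \<le> sqrt (ip f f * C)"
proof -
  have "(f x)\<^sup>2 \<le> ip f f * C"
    using eval_le[OF assms] mult_left_mono[OF _ ip_nonneg[OF assms(1)], of "K x x" C] K_bound[OF assms(2,2)] by linarith
  then show ?thesis by (metis real_sqrt_abs real_sqrt_le_mono)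
qed

text \<open>In the bound of \<open>eval_diff_le\<close> the kernel expression tends to K x x - 2 K x
  x + K x x = 0. Measurability and integrability of the members of \<open>H\<close> rest on this
  limit.\<close>

lemma mem_lim:
  assumes "f \<in> H" "x \<in> X"
  shows "(\<lambda>n. f (g n x)) \<longlonglongrightarrow> f x"
proof -
  have "(\<lambda>n. ip f f * (K (g n x) (g n x) - 2 * K (g n x) x + K x x)) \<longlonglongrightarrow> ip f f * (K x x - 2 * K x x + K x x)"
    by (intro tendsto_intros K_lim K_lim1 assms)
  then have "(\<lambda>n. ip f f * (K (g n x) (g n x) - 2 * K (g n x) x + K x x)) \<longlonglongrightarrow> 0" by simp
  then have "(\<lambda>n. (f (g n x) - f x)\<^sup>2) \<longlonglongrightarrow> 0"
    by (rule Lim_null_comparison[rotated]) (use assms eval_diff_le g_mem in auto)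
  then have "(\<lambda>n. sqrt ((f (g n x) - f x)\<^sup>2)) \<longlonglongrightarrow> sqrt 0" by (rule tendsto_real_sqrt)
  then show ?thesis by (simp add: tendsto_rabs_zero_iff LIM_zero_iff)
qed

lemma mem_measurable: "f \<in> H \<Longrightarrow> f \<in> borel_measurable M"
  by (rule borel_measurable_LIMSEQ_real[of M "\<lambda>n x. f (g n x)"])
    (use mem_lim space_M in \<open>auto intro: borel_measurable_integrable[OF integrable_simple]\<close>)

lemma mem_integrable: "f \<in> H \<Longrightarrow> integrable M f"
  using mem_bound space_M mem_measurable
  by (intro integrable_const_bound[where B = "sqrt (ip f f * C)"] AE_I2) auto

lemma integral_simple_lim:
  assumes "f \<in> H"
  shows "(\<lambda>n. LINT x|M. f (g n x)) \<longlonglongrightarrow> integral\<^sup>L M f"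
  by (rule integral_dominated_convergence[where w = "\<lambda>_. sqrt (ip f f * C)"])
    (use assms space_M mem_bound mem_lim g_mem in
      \<open>auto intro: borel_measurable_integrable[OF integrable_simple] mem_measurable\<close>)

text \<open>Represents the functional that integrates f along the simple function
  \<open>g n\<close>, and thus approximates the representer of integration. Its values and norms are
  what is passed to the limit.\<close>

definition integral_rep :: "nat \<Rightarrow> 'p \<Rightarrow> real" where
  "integral_rep n = kernel_comb (g n ` X) (weight n) (\<lambda>p. p)"

lemma integral_rep_mem: "integral_rep n \<in> H"
  unfolding integral_rep_def using finite_range g_mem by (intro kernel_comb_mem) auto

lemma ip_integral_rep: "f \<in> H \<Longrightarrow> ip f (integral_rep n) = (LINT x|M. f (g n x))"
  unfolding integral_rep_def integral_simple using finite_range g_mem by (intro ip_kernel_comb) auto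

lemma integral_rep_eq: "x \<in> X \<Longrightarrow> integral_rep n x = (LINT y|M. K x (g n y))"
  unfolding integral_rep_def integral_simple by (simp add: kernel_comb_def)

lemma kernel_measurable: "x \<in> X \<Longrightarrow> K x \<in> borel_measurable M"
  using mem_measurable[OF kernel_mem, of x] kernel_commute space_M
  by (subst measurable_cong[where g = "\<lambda>y. if y \<in> X then K y x else 0"]) auto

lemma integral_rep_lim:
  assumes "x \<in> X"
  shows "(\<lambda>n. integral_rep n x) \<longlonglongrightarrow> m"
proof -
  have "(\<lambda>n. LINT y|M. K x (g n y)) \<longlonglongrightarrow> (LINT y|M. K x y)"
  proof (rule integral_dominated_convergence[where w = "\<lambda>_. C"])
    have "(\<lambda>n. K x (g n y)) \<longlonglongrightarrow> K x y" if "y \<in> X" for y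
      using K_lim1[OF that assms] kernel_commute[OF assms] g_mem[OF that] that by simp
    then show "AE y in M. (\<lambda>n. K x (g n y)) \<longlonglongrightarrow> K x y" using space_M by auto
  qed (use assms space_M K_bound g_mem in
      \<open>auto intro: borel_measurable_integrable[OF integrable_simple] kernel_measurable\<close>)
  then show ?thesis using assms by (simp add: integral_rep_eq K_integral)
qed

text \<open>The squared norm is a double integral of the kernel over grid values. In the limit the
  inner integral is that of a kernel section, which is m everywhere, so the outer one gives m
  again.\<close>

lemma integral_rep_norm_lim: "(\<lambda>n. ip (integral_rep n) (integral_rep n)) \<longlonglongrightarrow> m"
proof -
  have "(\<lambda>n. LINT x|M. integral_rep n (g n x)) \<longlonglongrightarrow> (LINT x|M. m)"
  proof (rule integral_dominated_convergence[where w = "\<lambda>_. C"])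
    have "(\<lambda>n. integral_rep n (g n x)) \<longlonglongrightarrow> m" if "x \<in> X" for x
    proof -
      have "(\<lambda>n. LINT y|M. K (g n x) (g n y)) \<longlonglongrightarrow> (LINT y|M. K x y)"
        by (rule integral_dominated_convergence[where w = "\<lambda>_. C"])
          (use that space_M K_bound K_lim g_mem in
            \<open>auto intro: borel_measurable_integrable[OF integrable_simple] kernel_measurable\<close>)
      then show ?thesis using that g_mem by (simp add: integral_rep_eq K_integral)
    qed
    then show "AE x in M. (\<lambda>n. integral_rep n (g n x)) \<longlonglongrightarrow> m" using space_M by auto
    fix n
    have "\<bar>integral_rep n (g n x)\<bar> \<le> C" if "x \<in> X" for x
    proof -
      have "\<bar>integral_rep n (g n x)\<bar> \<le> (LINT y|M. \<bar>K (g n x) (g n y)\<bar>)"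
        using that g_mem by (simp add: integral_rep_eq integral_abs_bound)
      also have "\<dots> \<le> (LINT y|M. C)"
        using that g_mem K_bound space_M
        by (intro integral_mono integrable_abs integrable_simple[where h = "K (g n x)"]) auto
      finally show ?thesis using prob_space by simp
    qed
    then show "AE x in M. norm (integral_rep n (g n x)) \<le> C" using space_M by auto
  qed (auto intro: borel_measurable_integrable[OF integrable_simple])
  then show ?thesis using prob_space by (simp add: ip_integral_rep[OF integral_rep_mem])
qed

lemma integral_integral_rep: "integral\<^sup>L M (integral_rep n) = m"
proof -
  have int: "integrable M (K p)" if "p \<in> X" for p
    using that K_bound space_M kernel_measurable by (intro integrable_const_bound[where B = C] AE_I2) auto
  have "integral\<^sup>L M (integral_rep n) = (LINT x|M. (\<Sum>p\<in>g n ` X. weight n p * K p x))"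
    using space_M kernel_commute g_mem
    by (intro Bochner_Integration.integral_cong) (auto simp: integral_rep_def kernel_comb_def intro!: sum.cong)
  also have "\<dots> = (\<Sum>p\<in>g n ` X. weight n p * m)"
    using int g_mem by (subst Bochner_Integration.integral_sum) (auto intro!: sum.cong simp: K_integral)
  also have "\<dots> = (LINT x|M. m)" using integral_simple[of "\<lambda>_. m" n] by simp
  finally show ?thesis using prob_space by simp
qed

text \<open>The error functional is represented by the representer of integration minus that of the
  rule. Its squared norm expands to m - 2 m plus the double sum, where \<open>sum c J = 1\<close>
  produces the 2 m. The argument runs with \<open>integral_rep n\<close> and passes to the
  limit.\<close>

lemma
  assumes J: "finite J" "\<And>j. j \<in> J \<Longrightarrow> p j \<in> X" and c: "sum c J = 1"
  shows quadrature_error: "f \<in> H \<Longrightarrow> (integral\<^sup>L M f - (\<Sum>j\<in>J. c j * f (p j)))\<^sup>2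
      \<le> ip f f * ((\<Sum>i\<in>J. \<Sum>j\<in>J. c i * c j * K (p i) (p j)) - m)"
    and quadrature_error_nonneg: "m \<le> (\<Sum>i\<in>J. \<Sum>j\<in>J. c i * c j * K (p i) (p j))"
proof -
  let ?B = "(\<Sum>i\<in>J. \<Sum>j\<in>J. c i * c j * K (p i) (p j)) - m"
  define q where "q = kernel_comb J c p"
  have q: "q \<in> H" unfolding q_def using J by (rule kernel_comb_mem)
  have ipq: "ip f q = (\<Sum>j\<in>J. c j * f (p j))" if "f \<in> H" for f
    unfolding q_def using that J by (rule ip_kernel_comb)
  have qq: "ip q q = (\<Sum>i\<in>J. \<Sum>j\<in>J. c i * c j * K (p i) (p j))"
    unfolding ipq[OF q] using J by (simp add: q_def kernel_comb_def sum_distrib_left mult_ac)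
  \<comment> \<open>The factor 1 makes this an instance of \<open>ip_diff_diff\<close>.\<close>
  define h where "h n = (\<lambda>x. integral_rep n x - 1 * q x)" for n
  have neg: "(\<lambda>x. (- 1) * q x) \<in> H" by (rule scale_mem[OF q])
  have h_eq: "h n = (\<lambda>x. integral_rep n x + (- 1) * q x)" for n by (simp add: h_def)
  have h: "h n \<in> H" for n unfolding h_eq by (rule add_mem[OF integral_rep_mem neg])
  have "ip (h n) (h n) = ip (integral_rep n) (integral_rep n) - 2 * (\<Sum>j\<in>J. c j * integral_rep n (p j)) + ip q q" for n
    unfolding h_def ip_diff_diff[OF integral_rep_mem q] by (simp add: ipq[OF integral_rep_mem])
  moreover have "(\<lambda>n. ip (integral_rep n) (integral_rep n) - 2 * (\<Sum>j\<in>J. c j * integral_rep n (p j)) + ip q q)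
      \<longlonglongrightarrow> m - 2 * (\<Sum>j\<in>J. c j * m) + ip q q"
    using J by (intro tendsto_intros integral_rep_norm_lim integral_rep_lim) auto
  moreover have "m - 2 * (\<Sum>j\<in>J. c j * m) + ip q q = ?B"
    using c by (simp add: qq sum_distrib_right[symmetric])
  ultimately have lim: "(\<lambda>n. ip (h n) (h n)) \<longlonglongrightarrow> ?B" by simp
  have "0 \<le> ?B" by (rule LIMSEQ_le_const[OF lim]) (use ip_nonneg[OF h] in auto)
  then show "m \<le> (\<Sum>i\<in>J. \<Sum>j\<in>J. c i * c j * K (p i) (p j))" by simp
  assume f: "f \<in> H"
  have "ip f (h n) = (LINT x|M. f (g n x)) - (\<Sum>j\<in>J. c j * f (p j))" for n
    unfolding h_eq
    using ip_sym[OF f add_mem[OF integral_rep_mem[of n] neg]] ip_add[OF integral_rep_mem[of n] neg f]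
      ip_scale[OF q f, of "- 1"] ip_sym[OF f q] ip_sym[OF f integral_rep_mem[of n]]
    by (simp add: ip_integral_rep[OF f] ipq[OF f])
  then have le: "((LINT x|M. f (g n x)) - (\<Sum>j\<in>J. c j * f (p j)))\<^sup>2 \<le> ip f f * ip (h n) (h n)" for n
    using ip_Cauchy_Schwarz[OF f h, of n] by simp
  have "(\<lambda>n. ((LINT x|M. f (g n x)) - (\<Sum>j\<in>J. c j * f (p j)))\<^sup>2)
      \<longlonglongrightarrow> (integral\<^sup>L M f - (\<Sum>j\<in>J. c j * f (p j)))\<^sup>2"
    by (intro tendsto_intros integral_simple_lim f)
  then show "(integral\<^sup>L M f - (\<Sum>j\<in>J. c j * f (p j)))\<^sup>2 \<le> ip f f * ?B"
    by (rule LIMSEQ_le[OF _ tendsto_mult_left[OF lim]]) (use le in auto)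
qed

text \<open>The test functions are the approximate representers scaled to norm 1. Their integrals
  are m divided by the norm, and the norm tends to \<open>sqrt m\<close>.\<close>

lemma sqrt_le_SUP_integral:
  assumes "0 < m"
  shows "sqrt m \<le> (SUP f\<in>{f \<in> H. ip_norm ip f \<le> 1}. \<bar>integral\<^sup>L M f\<bar>)"
proof -
  \<comment> \<open>A real supremum is known to be an upper bound only when the set is bounded
    above.\<close>
  have bdd: "bdd_above ((\<lambda>f. \<bar>integral\<^sup>L M f\<bar>) ` {f \<in> H. ip_norm ip f \<le> 1})"
  proof (rule bdd_aboveI2)
    fix f assume f: "f \<in> {f \<in> H. ip_norm ip f \<le> 1}"
    then have le: "ip f f \<le> 1" by (simp add: ip_norm_def)
    have "\<bar>integral\<^sup>L M f\<bar> \<le> (LINT x|M. \<bar>f x\<bar>)" by (rule integral_abs_bound)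
    also have "\<dots> \<le> (LINT x|M. sqrt C)"
    proof (rule integral_mono)
      show "integrable M (\<lambda>x. \<bar>f x\<bar>)" using f by (intro integrable_abs mem_integrable) auto
      fix x assume "x \<in> space M"
      then have "\<bar>f x\<bar> \<le> sqrt (ip f f * C)" using f space_M mem_bound by auto
      also have "\<dots> \<le> sqrt C" using le C_nonneg mult_right_mono[of "ip f f" 1 C] by simp
      finally show "\<bar>f x\<bar> \<le> sqrt C" .
    qed simp
    finally show "\<bar>integral\<^sup>L M f\<bar> \<le> sqrt C" using prob_space by simp
  qed
  define N where "N n = ip_norm ip (integral_rep n)" for n
  have lim: "N \<longlonglongrightarrow> sqrt m"
    unfolding N_def[abs_def] ip_norm_def by (intro tendsto_real_sqrt integral_rep_norm_lim)
  have "(\<lambda>n. m / N n) \<longlonglongrightarrow> m / sqrt m"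
    using assms by (intro tendsto_intros lim) auto
  then have "(\<lambda>n. m / N n) \<longlonglongrightarrow> sqrt m" using assms by (simp add: real_div_sqrt)
  moreover have "\<forall>\<^sub>F n in sequentially. 0 < N n"
    using order_tendstoD(1)[OF lim, of 0] assms by simp
  then have "\<forall>\<^sub>F n in sequentially. m / N n \<le> (SUP f\<in>{f \<in> H. ip_norm ip f \<le> 1}. \<bar>integral\<^sup>L M f\<bar>)"
  proof eventually_elim
    case (elim n)
    define f where "f = (\<lambda>x. 1 / N n * integral_rep n x)"
    have f: "f \<in> H" unfolding f_def by (rule scale_mem[OF integral_rep_mem])
    have "ip f f = 1 / N n * (1 / N n * ip (integral_rep n) (integral_rep n))"
      using ip_scale[OF integral_rep_mem f, of "1 / N n" n] ip_scale[OF integral_rep_mem integral_rep_mem, of "1 / N n" n n]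
        ip_sym[OF integral_rep_mem f, of n] by (simp add: f_def)
    also have "ip (integral_rep n) (integral_rep n) = (N n)\<^sup>2"
      using ip_nonneg[OF integral_rep_mem] by (simp add: N_def ip_norm_def)
    finally have "ip_norm ip f \<le> 1" using elim by (simp add: ip_norm_def power2_eq_square)
    moreover have "\<bar>integral\<^sup>L M f\<bar> = m / N n"
      using elim assms integral_integral_rep[of n] by (simp add: f_def abs_mult)
    ultimately show ?case using cSUP_upper[OF _ bdd, of f] f by simp
  qed
  ultimately show ?thesis by (rule tendsto_upperbound) simp
qed

end

section \<open>The unit cube\<close>

interpretation lborel_product: product_sigma_finite "\<lambda>_::nat. lborel :: real measure"
  by standard

definition cube_measure :: "nat \<Rightarrow> (nat \<Rightarrow> real) measure" where
  "cube_measure s = restrict_space (lborel_pow s) (cube s)"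

lemma sets_cube [measurable]: "cube s \<in> sets (lborel_pow s)"
  unfolding cube_def by (rule sets_PiM_I_finite) auto

lemma space_cube_measure [simp]: "space (cube_measure s) = cube s"
  using sets.sets_into_space[OF sets_cube, of s] by (auto simp: cube_measure_def space_restrict_space)

lemma prob_space_cube_measure: "prob_space (cube_measure s)"
proof
  have "emeasure (cube_measure s) (cube s) = emeasure (lborel_pow s) (cube s)"
    unfolding cube_measure_def using sets_cube sets.sets_into_space[OF sets_cube, of s]
    by (intro emeasure_restrict_space) (auto simp: Int_absorb2)
  also have "\<dots> = (\<Prod>j\<in>{1..s}. emeasure lborel {0..<1::real})"
    unfolding cube_def by (rule lborel_product.emeasure_PiM) auto
  finally show "emeasure (cube_measure s) (space (cube_measure s)) = 1" by simp
qed

lemma set_integral_cube: "(LINT x:cube s|lborel_pow s. f x) = integral\<^sup>L (cube_measure s) f"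
  for f :: "_ \<Rightarrow> real"
  unfolding cube_measure_def set_lebesgue_integral_def
  by (subst integral_restrict_space[OF sets.Int[OF sets_cube sets.top]]) simp

lemma measurable_cube_component [measurable (raw)]:
  "j \<in> {1..s} \<Longrightarrow> (\<lambda>x. x j) \<in> borel_measurable (cube_measure s)"
  unfolding cube_measure_def by (rule measurable_restrict_space1) simp

text \<open>The indicator of the cube is absorbed into the factors, with the constant 1 for
  coordinates outside u. Then the product formula for the full product measure applies.\<close>

lemma
  fixes h :: "nat \<Rightarrow> real \<Rightarrow> real"
  assumes u: "u \<subseteq> {1..s}" and h: "\<And>j. j \<in> u \<Longrightarrow> integrable unit_measure (h j)"
  shows integrable_cube_prod: "integrable (cube_measure s) (\<lambda>x. \<Prod>j\<in>u. h j (x j))"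
    and integral_cube_prod: "(LINT x|cube_measure s. (\<Prod>j\<in>u. h j (x j))) = (\<Prod>j\<in>u. integral\<^sup>L unit_measure (h j))"
proof -
  define h' where "h' j t = indicator {0..<1} t * (if j \<in> u then h j t else 1)" for j t
  have eq: "indicator (cube s) x *\<^sub>R (\<Prod>j\<in>u. h j (x j)) = (\<Prod>j\<in>{1..s}. h' j (x j))"
    if x: "x \<in> space (lborel_pow s)" for x
  proof -
    have "indicator (cube s) x = (\<Prod>j\<in>{1..s}. indicator {0..<1} (x j) :: real)"
    proof (cases "x \<in> cube s")
      case True
      then have "(\<Prod>j\<in>{1..s}. indicator {0..<1} (x j) :: real) = (\<Prod>j\<in>{1..s}. 1)"
        by (intro prod.cong) (auto simp: cube_def PiE_iff)
      then show ?thesis using True by simp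
    next
      case False
      then obtain j where "j \<in> {1..s}" "x j \<notin> {0..<1}"
        using x by (auto simp: cube_def PiE_iff space_PiM)
      then have "(\<Prod>j\<in>{1..s}. indicator {0..<1} (x j) :: real) = 0"
        by (intro prod_zero bexI[of _ j]) simp_all
      then show ?thesis using False by simp
    qed
    moreover have "(\<Prod>j\<in>u. h j (x j)) = (\<Prod>j\<in>{1..s}. if j \<in> u then h j (x j) else 1)"
      using u by (subst prod.inter_restrict[symmetric]) (auto simp: Int_absorb1)
    ultimately show ?thesis by (simp add: h'_def prod.distrib)
  qed
  have int: "integrable lborel (h' j)" for j
  proof (cases "j \<in> u")
    case True
    then show ?thesis using h[of j] by (simp add: h'_def[abs_def] unit_measure_def integrable_restrict_space)
  qed (simp add: h'_def[abs_def])
  have "integral\<^sup>L lborel (h' j) = (if j \<in> u then integral\<^sup>L unit_measure (h j) else 1)" for j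
    by (simp add: h'_def[abs_def] integral_unit_measure)
  then have "(\<Prod>j\<in>u. integral\<^sup>L unit_measure (h j)) = (\<Prod>j\<in>{1..s}. integral\<^sup>L lborel (h' j))"
    using u by (simp add: prod.inter_restrict[symmetric] Int_absorb1)
  moreover have "(LINT x|cube_measure s. (\<Prod>j\<in>u. h j (x j))) = (LINT x|lborel_pow s. (\<Prod>j\<in>{1..s}. h' j (x j)))"
    unfolding cube_measure_def
    by (subst integral_restrict_space[OF sets.Int[OF sets_cube sets.top]])
      (rule Bochner_Integration.integral_cong[OF refl eq])
  ultimately show "(LINT x|cube_measure s. (\<Prod>j\<in>u. h j (x j))) = (\<Prod>j\<in>u. integral\<^sup>L unit_measure (h j))"
    using lborel_product.product_integral_prod[of "{1..s}" h'] int by simp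
  have "integrable (lborel_pow s) (\<lambda>x. \<Prod>j\<in>{1..s}. h' j (x j))"
    using int by (intro lborel_product.product_integrable_prod) auto
  then show "integrable (cube_measure s) (\<lambda>x. \<Prod>j\<in>u. h j (x j))"
    unfolding cube_measure_def
    by (subst integrable_restrict_space[OF sets.Int[OF sets_cube sets.top]])
      (simp only: Bochner_Integration.integrable_cong[OF refl eq])
qed

text \<open>The indicator of the exceptional set is a product with a single factor, so its integral
  over the cube equals its integral over the interval, which is 0.\<close>

lemma AE_cube_component:
  assumes j: "j \<in> {1..s}" and ae: "AE t in unit_measure. P t" and [measurable]: "Measurable.pred borel P"
  shows "AE x in cube_measure s. P (x j)"
proof -
  let ?h = "\<lambda>t. indicator {t. \<not> P t} t :: real"
  have int: "integrable unit_measure ?h"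
    by (rule integrable_unit_measure[where B = 1]) (auto simp: indicator_def)
  have "integral\<^sup>L unit_measure ?h = (LINT t|unit_measure. 0)"
    using ae by (intro integral_cong_AE borel_measurable_integrable[OF int]) (auto simp: indicator_def)
  then have "(LINT x|cube_measure s. ?h (x j)) = 0"
    using integral_cube_prod[of "{j}" s "\<lambda>_. ?h"] j int by simp
  moreover have "integrable (cube_measure s) (\<lambda>x. ?h (x j))"
    using integrable_cube_prod[of "{j}" s "\<lambda>_. ?h"] j int by simp
  ultimately have "AE x in cube_measure s. ?h (x j) = 0"
    by (subst (asm) integral_nonneg_eq_0_iff_AE) auto
  then show ?thesis by eventually_elim (auto simp: indicator_def split: if_splits)
qed

text \<open>These are the simple functions \<open>g n\<close> required by \<open>rkhs_prob\<close>.
  Rounding down, rather than to the nearest grid value, stays inside the half-open cube.\<close>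

definition grid_point :: "nat \<Rightarrow> nat \<Rightarrow> (nat \<Rightarrow> real) \<Rightarrow> nat \<Rightarrow> real" where
  "grid_point s n x = (\<lambda>j\<in>{1..s}. real_of_int \<lfloor>x j * real (Suc n)\<rfloor> / real (Suc n))"

lemma grid_point_mem:
  assumes "x \<in> cube s" "j \<in> {1..s}"
  shows "grid_point s n x j \<in> (\<lambda>k. real_of_int k / real (Suc n)) ` {0..<int (Suc n)}"
proof -
  have x: "0 \<le> x j" "x j < 1" using assms by (auto simp: cube_def PiE_iff)
  then have "0 \<le> x j * real (Suc n)" "x j * real (Suc n) < real (Suc n)" by simp_all
  then have "0 \<le> \<lfloor>x j * real (Suc n)\<rfloor>" "\<lfloor>x j * real (Suc n)\<rfloor> < int (Suc n)"
    by (simp_all only: zero_le_floor floor_less_iff of_int_of_nat_eq)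
  then show ?thesis using assms by (auto simp: grid_point_def)
qed

lemma grid_point_in_cube: "x \<in> cube s \<Longrightarrow> grid_point s n x \<in> cube s"
  using grid_point_mem[of x s _ n] by (fastforce simp: cube_def PiE_iff grid_point_def)

lemma finite_grid: "finite (grid_point s n ` cube s)"
proof (rule finite_subset)
  show "grid_point s n ` cube s \<subseteq> (\<Pi>\<^sub>E j\<in>{1..s}. (\<lambda>k. real_of_int k / real (Suc n)) ` {0..<int (Suc n)})"
    using grid_point_mem by (auto simp: PiE_iff grid_point_def)
qed (auto intro: finite_PiE)

lemma sets_grid_cell: "{x \<in> cube s. grid_point s n x = p} \<in> sets (cube_measure s)"
proof (cases "p \<in> extensional {1..s}")
  case True
  then have "grid_point s n x = p \<longleftrightarrow> (\<forall>j\<in>{1..s}. real_of_int \<lfloor>x j * real (Suc n)\<rfloor> / real (Suc n) = p j)" for x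
    by (auto simp: grid_point_def extensional_def restrict_def fun_eq_iff)
  moreover have "{x \<in> space (cube_measure s). \<forall>j\<in>{1..s}. real_of_int \<lfloor>x j * real (Suc n)\<rfloor> / real (Suc n) = p j}
      \<in> sets (cube_measure s)"
  proof (rule sets.sets_Collect_finite_All)
    fix j assume j: "j \<in> {1..s}"
    have "(\<lambda>x. real_of_int \<lfloor>x j * real (Suc n)\<rfloor> / real (Suc n)) \<in> borel_measurable (cube_measure s)"
      by (rule measurable_compose[OF measurable_cube_component[OF j]]) measurable
    then show "{x \<in> space (cube_measure s). real_of_int \<lfloor>x j * real (Suc n)\<rfloor> / real (Suc n) = p j}
        \<in> sets (cube_measure s)"
      by (rule borel_measurable_eq) simp
  qed simp
  ultimately show ?thesis by (simp only: space_cube_measure)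
next
  case False
  then have "{x \<in> cube s. grid_point s n x = p} = {}" by (auto simp: grid_point_def)
  then show ?thesis by (simp only: sets.empty_sets)
qed

lemma grid_point_lim:
  assumes "j \<in> {1..s}"
  shows "(\<lambda>n. grid_point s n x j) \<longlonglongrightarrow> x j"
proof -
  have "\<bar>grid_point s n x j - x j\<bar> \<le> inverse (real (Suc n))" for n
  proof -
    have "grid_point s n x j - x j = (real_of_int \<lfloor>x j * real (Suc n)\<rfloor> - x j * real (Suc n)) / real (Suc n)"
      using assms by (simp add: grid_point_def field_simps del: of_nat_Suc)
    also have "\<bar>\<dots>\<bar> \<le> 1 / real (Suc n)"
      unfolding abs_divide by (intro divide_mono) linarith+
    finally show ?thesis by (simp add: inverse_eq_divide)
  qed
  then have "\<forall>n. norm (grid_point s n x j - x j) \<le> inverse (real (Suc n))" by (simp only: real_norm_def) simp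
  then have "(\<lambda>n. grid_point s n x j - x j) \<longlonglongrightarrow> 0"
    by (rule Lim_null_comparison[OF always_eventually LIMSEQ_inverse_real_of_nat])
  then show ?thesis by (rule LIM_zero_cancel)
qed

section \<open>The Sobolev space as an instance of \<open>rkhs_prob\<close>\<close>

lemma tendsto_unit_kernel:
  assumes "(f \<longlongrightarrow> a) F" "(g \<longlongrightarrow> c) F"
  shows "((\<lambda>n. unit_kernel \<alpha> (f n) (g n)) \<longlongrightarrow> unit_kernel \<alpha> a c) F"
proof -
  have "isCont (\<lambda>z. unit_kernel \<alpha> (fst z) (snd z)) (a, c)"
    using continuous_unit_kernel[of UNIV fst snd \<alpha>]
    by (auto simp: continuous_on_eq_continuous_at intro!: continuous_intros)
  from isCont_tendsto_compose[OF this tendsto_Pair[OF assms]] show ?thesis by simp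
qed

lemma borel_measurable_unit_kernel [measurable (raw)]:
  assumes [measurable]: "f \<in> borel_measurable M" "g \<in> borel_measurable M"
  shows "(\<lambda>x. unit_kernel \<alpha> (f x) (g x)) \<in> borel_measurable M"
proof -
  have "(\<lambda>z. unit_kernel \<alpha> (fst z) (snd z)) \<in> borel_measurable borel"
    by (intro borel_measurable_continuous_onI continuous_unit_kernel continuous_intros)
  from measurable_compose[OF borel_measurable_Pair[OF assms] this] show ?thesis by simp
qed

lemma integral_unit_kernel:
  assumes "1 \<le> \<alpha>" "x \<in> {0..1}"
  shows "integral\<^sup>L unit_measure (unit_kernel \<alpha> x) = 0"
  by (rule integral_unit_measure_eq[OF continuous_unit_kernel unit_kernel_has_integral_0[OF assms]])
    (auto intro: continuous_intros)

text \<open>Integrating out one argument annihilates the product over every nonempty u, since the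
  univariate kernel has mean zero. Hence the constant m of the locale is
  \<open>\<gamma> {}\<close>.\<close>

lemma rkhs_prob_sobolev:
  assumes "1 \<le> \<alpha>" "rkhs (cube s) (sobolev_kernel s \<alpha> \<gamma>) H ip"
  shows "\<exists>C. rkhs_prob (cube s) (sobolev_kernel s \<alpha> \<gamma>) H ip (cube_measure s) (grid_point s) C (\<gamma> {})"
proof -
  obtain B where B: "\<And>x y. x \<in> {0..1} \<Longrightarrow> y \<in> {0..1} \<Longrightarrow> \<bar>unit_kernel \<alpha> x y\<bar> \<le> B"
    using unit_kernel_bounded[of \<alpha>] by blast
  have comp: "x j \<in> {0..1}" if "x \<in> cube s" "j \<in> {1..s}" for x j
    using that by (auto simp: cube_def PiE_iff less_imp_le)
  define C where "C = (\<Sum>u\<in>Pow {1..s}. \<bar>\<gamma> u\<bar> * (\<Prod>j\<in>u. B))"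
  interpret rkhs "cube s" "sobolev_kernel s \<alpha> \<gamma>" H ip by fact
  interpret prob_space "cube_measure s" by (rule prob_space_cube_measure)
  have "rkhs_prob (cube s) (sobolev_kernel s \<alpha> \<gamma>) H ip (cube_measure s) (grid_point s) C (\<gamma> {})"
  proof unfold_locales
    fix x y assume xy: "x \<in> cube s" "y \<in> cube s"
    have "\<bar>sobolev_kernel s \<alpha> \<gamma> x y\<bar> \<le> (\<Sum>u\<in>Pow {1..s}. \<bar>\<gamma> u * (\<Prod>j\<in>u. unit_kernel \<alpha> (x j) (y j))\<bar>)"
      unfolding sobolev_kernel_eq by (rule sum_abs)
    also have "\<dots> \<le> C"
      unfolding C_def abs_mult abs_prod
      using comp xy by (intro sum_mono mult_left_mono prod_mono conjI B) auto
    finally show "\<bar>sobolev_kernel s \<alpha> \<gamma> x y\<bar> \<le> C" .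
    show "(\<lambda>n. sobolev_kernel s \<alpha> \<gamma> (grid_point s n x) (grid_point s n y)) \<longlonglongrightarrow> sobolev_kernel s \<alpha> \<gamma> x y"
      unfolding sobolev_kernel_eq
      by (intro tendsto_intros tendsto_unit_kernel grid_point_lim) auto
    show "(\<lambda>n. sobolev_kernel s \<alpha> \<gamma> (grid_point s n x) y) \<longlonglongrightarrow> sobolev_kernel s \<alpha> \<gamma> x y"
      unfolding sobolev_kernel_eq
      by (intro tendsto_intros tendsto_unit_kernel grid_point_lim) auto
  next
    fix x assume x: "x \<in> cube s"
    have int: "integrable unit_measure (unit_kernel \<alpha> (x j))" if "j \<in> {1..s}" for j
      using B comp[OF x that] by (intro integrable_unit_measure[where B = B]) auto
    have "(LINT y|cube_measure s. sobolev_kernel s \<alpha> \<gamma> x y)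
        = (\<Sum>u\<in>Pow {1..s}. \<gamma> u * (LINT y|cube_measure s. (\<Prod>j\<in>u. unit_kernel \<alpha> (x j) (y j))))"
      unfolding sobolev_kernel_eq
      using int by (subst Bochner_Integration.integral_sum)
        (auto intro!: integrable_mult_right integrable_cube_prod)
    also have "\<dots> = (\<Sum>u\<in>Pow {1..s}. if u = {} then \<gamma> {} else 0)"
    proof (intro sum.cong refl)
      fix u assume u: "u \<in> Pow {1..s}"
      have "(LINT y|cube_measure s. (\<Prod>j\<in>u. unit_kernel \<alpha> (x j) (y j)))
          = (\<Prod>j\<in>u. integral\<^sup>L unit_measure (unit_kernel \<alpha> (x j)))"
        using u int by (intro integral_cube_prod) auto
      also have "\<dots> = (\<Prod>j\<in>u. 0)"
        using u comp[OF x] assms(1) by (intro prod.cong integral_unit_kernel) auto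
      finally show "\<gamma> u * (LINT y|cube_measure s. (\<Prod>j\<in>u. unit_kernel \<alpha> (x j) (y j)))
          = (if u = {} then \<gamma> {} else 0)"
        using u finite_subset[of u "{1..s}"] by auto
    qed
    finally show "(LINT y|cube_measure s. sobolev_kernel s \<alpha> \<gamma> x y) = \<gamma> {}" by simp
  qed (use grid_point_in_cube finite_grid sets_grid_cell in auto)
  then show ?thesis by blast
qed

section \<open>Lipschitz bounds for the univariate kernel\<close>

lemma lipschitz_on_sum:
  fixes f :: "'i \<Rightarrow> real \<Rightarrow> real"
  assumes "finite I" "\<And>i. i \<in> I \<Longrightarrow> \<exists>L. L-lipschitz_on S (f i)"
  shows "\<exists>L. L-lipschitz_on S (\<lambda>x. \<Sum>i\<in>I. f i x)"
  using assms
proof (induction I)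
  case empty
  then show ?case by (intro exI[of _ 0]) (simp add: lipschitz_on_def)
next
  case (insert i I)
  then obtain L M where "L-lipschitz_on S (f i)" "M-lipschitz_on S (\<lambda>x. \<Sum>i\<in>I. f i x)" by blast
  from lipschitz_on_add[OF this] insert show ?case by auto
qed

lemma unit_kernel_lipschitz:
  assumes w: "w \<in> {0..1}"
  shows "\<exists>L. L-lipschitz_on {0..1} (unit_kernel \<alpha> w)"
proof -
  have "\<exists>L. L-lipschitz_on {0..1} (\<lambda>y. \<Sum>r=1..\<alpha>. bernoulli_fun r w * bernoulli_fun r y)"
    using bernoulli_fun_lipschitz by (intro lipschitz_on_sum) (auto intro: lipschitz_on_cmult_real)
  moreover have "\<exists>L. L-lipschitz_on {0..1} (\<lambda>y. (-1) ^ (\<alpha> + 1) * bernoulli_fun (2 * \<alpha>) \<bar>w - y\<bar>)"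
  proof -
    obtain L where L: "L-lipschitz_on {0..1} (bernoulli_fun (2 * \<alpha>))" using bernoulli_fun_lipschitz by blast
    have "1-lipschitz_on {0..1} (\<lambda>y. \<bar>w - y\<bar>)" by (auto simp: lipschitz_on_def dist_real_def)
    moreover have "(\<lambda>y. \<bar>w - y\<bar>) ` {0..1} \<subseteq> {0..1}" using w by auto
    ultimately have "(L * 1)-lipschitz_on {0..1} (\<lambda>y. bernoulli_fun (2 * \<alpha>) \<bar>w - y\<bar>)"
      using L by (intro lipschitz_on_compose2) (auto intro: lipschitz_on_subset)
    from lipschitz_on_cmult_real[OF this] show ?thesis by blast
  qed
  ultimately obtain L M where "L-lipschitz_on {0..1} (\<lambda>y. \<Sum>r=1..\<alpha>. bernoulli_fun r w * bernoulli_fun r y)"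
    "M-lipschitz_on {0..1} (\<lambda>y. (-1) ^ (\<alpha> + 1) * bernoulli_fun (2 * \<alpha>) \<bar>w - y\<bar>)" by blast
  from lipschitz_on_add[OF this] show ?thesis by (auto simp: unit_kernel_def[abs_def])
qed

lemma unit_kernel_diag_lipschitz: "\<exists>L. L-lipschitz_on {0..1} (\<lambda>x. unit_kernel \<alpha> x x)"
proof -
  have "\<exists>L. L-lipschitz_on {0..1} (\<lambda>x. bernoulli_fun r x * bernoulli_fun r x)" for r
  proof -
    have "bounded (bernoulli_fun r ` {0..1})"
      using compact_continuous_image[OF continuous_on_bernoulli_fun compact_Icc] by (rule compact_imp_bounded)
    then obtain A where A: "\<And>x. x \<in> {0..1} \<Longrightarrow> \<bar>bernoulli_fun r x\<bar> \<le> A" unfolding bounded_iff by fastforce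
    have "0 \<le> A" using order_trans[OF abs_ge_zero A[of 0]] by simp
    then show ?thesis using bernoulli_fun_lipschitz[of r] lipschitz_on_mult_bounded A by blast
  qed
  then have "\<exists>L. L-lipschitz_on {0..1} (\<lambda>x. \<Sum>r=1..\<alpha>. bernoulli_fun r x * bernoulli_fun r x)"
    by (intro lipschitz_on_sum) auto
  then obtain L where "L-lipschitz_on {0..1} (\<lambda>x. \<Sum>r=1..\<alpha>. bernoulli_fun r x * bernoulli_fun r x)" ..
  \<comment> \<open>On the diagonal the distance is 0, so the last term of the kernel only adds a
    constant.\<close>
  then have "L-lipschitz_on {0..1} (\<lambda>x. unit_kernel \<alpha> x x)"
    by (simp add: unit_kernel_def lipschitz_on_def dist_real_def)
  then show ?thesis by blast
qed

text \<open>The digital shift invariant kernel associated with \<open>unit_kernel\<close>: both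
  points undergo the same random shift, as all points of the rule do.\<close>

definition shifted_kernel :: "nat \<Rightarrow> nat \<Rightarrow> real \<Rightarrow> real \<Rightarrow> real" where
  "shifted_kernel b \<alpha> x y = (LINT t|unit_measure. unit_kernel \<alpha> (digit_add b x t) (digit_add b y t))"

lemma shifted_kernel_commute: "shifted_kernel b \<alpha> x y = shifted_kernel b \<alpha> y x"
  by (simp add: shifted_kernel_def unit_kernel_commute)

text \<open>With equal arguments only one shifted number occurs, and the shift preserves the
  integral of the diagonal. Hence neither x nor b matters.\<close>

lemma shifted_kernel_diag:
  assumes "2 \<le> b"
  shows "shifted_kernel b \<alpha> x x = integral {0..1} (\<lambda>t. unit_kernel \<alpha> t t)"
proof -
  have cont: "continuous_on A (\<lambda>t. unit_kernel \<alpha> t t)" for A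
    by (intro continuous_unit_kernel continuous_intros)
  obtain L where "L-lipschitz_on {0..1} (\<lambda>t. unit_kernel \<alpha> t t)" using unit_kernel_diag_lipschitz by blast
  then have "shifted_kernel b \<alpha> x x = integral\<^sup>L unit_measure (\<lambda>t. unit_kernel \<alpha> t t)"
    unfolding shifted_kernel_def
    by (intro integral_digit_add[OF assms, of L "\<lambda>t. unit_kernel \<alpha> t t"] borel_measurable_continuous_onI cont)
  also have "\<dots> = integral {0..1} (\<lambda>t. unit_kernel \<alpha> t t)"
    by (intro integral_unit_measure_eq cont integrable_integral integrable_continuous_real)
  finally show ?thesis .
qed

text \<open>Exchange the two integrals. For a fixed shift t, adding t to the variable y preserves
  integrals, so the inner integral is the mean of a section of \<open>unit_kernel\<close>, which is
  0.\<close>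

lemma
  assumes b: "2 \<le> b" and \<alpha>: "1 \<le> \<alpha>"
  shows integrable_shifted_kernel: "integrable unit_measure (shifted_kernel b \<alpha> x)"
    and integral_shifted_kernel: "integral\<^sup>L unit_measure (shifted_kernel b \<alpha> x) = 0"
proof -
  obtain B where B: "\<And>x y. x \<in> {0..1} \<Longrightarrow> y \<in> {0..1} \<Longrightarrow> \<bar>unit_kernel \<alpha> x y\<bar> \<le> B"
    using unit_kernel_bounded[of \<alpha>] by blast
  let ?f = "\<lambda>y t. unit_kernel \<alpha> (digit_add b x t) (digit_add b y t)"
  interpret pair_prob_space unit_measure unit_measure ..
  have [measurable]: "fst \<in> borel_measurable (unit_measure \<Otimes>\<^sub>M unit_measure)"
    "snd \<in> borel_measurable (unit_measure \<Otimes>\<^sub>M unit_measure)"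
    by (rule measurable_compose[OF measurable_fst], simp add: measurable_unit_measure,
        rule measurable_compose[OF measurable_snd], simp add: measurable_unit_measure)
  have "(\<lambda>z. ?f (fst z) (snd z)) \<in> borel_measurable (unit_measure \<Otimes>\<^sub>M unit_measure)" by measurable
  then have int: "integrable (unit_measure \<Otimes>\<^sub>M unit_measure) (\<lambda>(y, t). ?f y t)"
    using B digit_add_bounds[OF b]
    by (intro P.integrable_const_bound[where B = B] AE_I2) (auto simp: case_prod_beta)
  show "integrable unit_measure (shifted_kernel b \<alpha> x)"
    using integrable_fst[OF int] by (simp add: shifted_kernel_def[abs_def])
  have inner: "(LINT y|unit_measure. ?f y t) = 0" for t
  proof -
    let ?w = "digit_add b x t"
    have w: "?w \<in> {0..1}" by (rule digit_add_bounds[OF b])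
    obtain L where "L-lipschitz_on {0..1} (unit_kernel \<alpha> ?w)" using unit_kernel_lipschitz[OF w] by blast
    then have "(LINT y|unit_measure. unit_kernel \<alpha> ?w (digit_add b t y)) = integral\<^sup>L unit_measure (unit_kernel \<alpha> ?w)"
      by (rule integral_digit_add[OF b]) measurable
    then show ?thesis using integral_unit_kernel[OF \<alpha> w] by (simp add: digit_add_commute[of b _ t])
  qed
  have "integral\<^sup>L unit_measure (shifted_kernel b \<alpha> x) = (LINT t|unit_measure. LINT y|unit_measure. ?f y t)"
    unfolding shifted_kernel_def[abs_def] using Fubini_integral[OF int] by simp
  then show "integral\<^sup>L unit_measure (shifted_kernel b \<alpha> x) = 0" by (simp add: inner)
qed

section \<open>Point sets with small mean square error\<close>

text \<open>
  The points are chosen one after the other: since the new cross terms have mean zero, some choice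
  of the new point makes their sum nonpositive.
\<close>

lemma (in prob_space) greedy_points:
  fixes F :: "'a \<Rightarrow> 'a \<Rightarrow> real"
  assumes int: "\<And>x. x \<in> space M \<Longrightarrow> integrable M (F x)"
    and zero: "\<And>x. x \<in> space M \<Longrightarrow> integral\<^sup>L M (F x) = 0"
    and comm: "\<And>x y. x \<in> space M \<Longrightarrow> y \<in> space M \<Longrightarrow> F x y = F y x"
    and diag: "\<And>x. x \<in> space M \<Longrightarrow> F x x \<le> D"
  shows "\<exists>p. (\<forall>i<N. p i \<in> space M) \<and> (\<Sum>i<N. \<Sum>j<N. F (p i) (p j)) \<le> real N * D"
proof (induction N)
  case 0
  then show ?case by simp
next
  case (Suc N)
  then obtain p where p: "\<And>i. i < N \<Longrightarrow> p i \<in> space M"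
    and le: "(\<Sum>i<N. \<Sum>j<N. F (p i) (p j)) \<le> real N * D" by blast
  let ?S = "\<lambda>x. \<Sum>i<N. F (p i) x"
  have intS: "integrable M ?S" using p int by auto
  have "expectation ?S = (\<Sum>i<N. expectation (F (p i)))"
    using p int by (intro Bochner_Integration.integral_sum) auto
  also have "\<dots> = 0" using p zero by simp
  finally have S0: "expectation ?S = 0" .
  have "\<exists>x\<in>space M. ?S x \<le> 0"
  proof (rule ccontr)
    assume "\<not> (\<exists>x\<in>space M. ?S x \<le> 0)"
    then have "AE x in M. 0 < ?S x" by (auto simp: not_le)
    with intS have "0 < expectation ?S" by (rule expectation_greater)
    with S0 show False by simp
  qed
  then obtain x where x: "x \<in> space M" "?S x \<le> 0" by blast
  define p' where "p' = p(N := x)"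
  have p': "p' i = p i" if "i < N" for i using that by (simp add: p'_def)
  have p'N: "p' N = x" by (simp add: p'_def)
  have "(\<Sum>i<Suc N. \<Sum>j<Suc N. F (p' i) (p' j))
      = (\<Sum>i<N. \<Sum>j<N. F (p i) (p j)) + ?S x + (\<Sum>j<N. F x (p j)) + F x x"
    using p'N by (simp add: sum.distrib p')
  also have "(\<Sum>j<N. F x (p j)) = ?S x" using p x comm by (intro sum.cong) auto
  also have "(\<Sum>i<N. \<Sum>j<N. F (p i) (p j)) + ?S x + ?S x + F x x \<le> real (Suc N) * D"
    using le x diag[OF x(1)] by (simp add: algebra_simps)
  finally show ?case
    using p x by (intro exI[of _ p']) (auto simp: p'_def less_Suc_eq)
qed

text \<open>The common value of the averaged kernel sum at all pairs of equal points; it becomes the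
  constant \<open>D\<close> of \<open>greedy_points\<close>.\<close>

definition shift_variance :: "nat \<Rightarrow> nat \<Rightarrow> (nat set \<Rightarrow> real) \<Rightarrow> real" where
  "shift_variance s \<alpha> \<gamma> = (\<Sum>u\<in>Pow {1..s} - {{}}. \<gamma> u * integral {0..1} (\<lambda>t. unit_kernel \<alpha> t t) ^ card u)"

text \<open>An application of \<open>greedy_points\<close>. The sum omits the empty set, whose term
  is the constant \<open>\<gamma> {}\<close> and would spoil the mean zero property.\<close>

lemma exists_shifted_points:
  assumes b: "2 \<le> b" and \<alpha>: "1 \<le> \<alpha>"
  shows "\<exists>p. (\<forall>i<N. p i \<in> cube s) \<and>
    (\<Sum>i<N. \<Sum>j<N. \<Sum>u\<in>Pow {1..s} - {{}}. \<gamma> u * (\<Prod>k\<in>u. shifted_kernel b \<alpha> (p i k) (p j k)))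
      \<le> real N * shift_variance s \<alpha> \<gamma>"
proof -
  let ?F = "\<lambda>x y. \<Sum>u\<in>Pow {1..s} - {{}}. \<gamma> u * (\<Prod>k\<in>u. shifted_kernel b \<alpha> (x k) (y k))"
  interpret prob_space "cube_measure s" by (rule prob_space_cube_measure)
  have int: "integrable (cube_measure s) (\<lambda>y. \<gamma> u * (\<Prod>k\<in>u. shifted_kernel b \<alpha> (x k) (y k)))"
    if "u \<subseteq> {1..s}" for u x
    using that by (intro integrable_mult_right integrable_cube_prod integrable_shifted_kernel[OF b \<alpha>])
  have "\<exists>p. (\<forall>i<N. p i \<in> space (cube_measure s)) \<and> (\<Sum>i<N. \<Sum>j<N. ?F (p i) (p j)) \<le> real N * shift_variance s \<alpha> \<gamma>"
  proof (rule greedy_points)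
    fix x
    show "integrable (cube_measure s) (?F x)" using int by (intro Bochner_Integration.integrable_sum) auto
    have "integral\<^sup>L (cube_measure s) (?F x)
        = (\<Sum>u\<in>Pow {1..s} - {{}}. \<gamma> u * (LINT y|cube_measure s. (\<Prod>k\<in>u. shifted_kernel b \<alpha> (x k) (y k))))"
      using int by (subst Bochner_Integration.integral_sum) auto
    also have "\<dots> = 0"
    proof (intro sum.neutral ballI)
      fix u assume u: "u \<in> Pow {1..s} - {{}}"
      then have "(LINT y|cube_measure s. (\<Prod>k\<in>u. shifted_kernel b \<alpha> (x k) (y k)))
          = (\<Prod>k\<in>u. integral\<^sup>L unit_measure (shifted_kernel b \<alpha> (x k)))"
        by (intro integral_cube_prod integrable_shifted_kernel[OF b \<alpha>]) auto
      moreover have "finite u" "u \<noteq> {}" using u finite_subset[of u "{1..s}"] by auto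
      ultimately show "\<gamma> u * (LINT y|cube_measure s. (\<Prod>k\<in>u. shifted_kernel b \<alpha> (x k) (y k))) = 0"
        by (simp add: integral_shifted_kernel[OF b \<alpha>] card_gt_0_iff)
    qed
    finally show "integral\<^sup>L (cube_measure s) (?F x) = 0" .
    show "?F x x \<le> shift_variance s \<alpha> \<gamma>"
      by (simp add: shift_variance_def shifted_kernel_diag[OF b])
    fix y show "?F x y = ?F y x" by (simp add: shifted_kernel_commute)
  qed
  then show ?thesis by simp
qed

text \<open>\<open>quadrature_error\<close> with equal weights 1 / N. The second claim says that the
  bound is nonnegative, which is needed when it is integrated over the shift.\<close>

lemma (in rkhs_prob) quadrature_sup_le:
  assumes N: "1 \<le> N" and p: "\<And>i. i < N \<Longrightarrow> p i \<in> X"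
  shows "(SUP f\<in>{f \<in> H. ip_norm ip f \<le> 1}. \<bar>integral\<^sup>L M f - (\<Sum>i<N. f (p i)) / real N\<bar>)\<^sup>2
    \<le> (\<Sum>i<N. \<Sum>j<N. K (p i) (p j)) / (real N)\<^sup>2 - m"
    and "m \<le> (\<Sum>i<N. \<Sum>j<N. K (p i) (p j)) / (real N)\<^sup>2"
proof -
  let ?A = "{f \<in> H. ip_norm ip f \<le> 1}"
  let ?e = "\<lambda>f. \<bar>integral\<^sup>L M f - (\<Sum>i<N. f (p i)) / real N\<bar>"
  let ?B = "(\<Sum>i<N. \<Sum>j<N. K (p i) (p j)) / (real N)\<^sup>2 - m"
  have c: "sum (\<lambda>_. 1 / real N) {..<N} = 1" using N by simp
  have KK: "(\<Sum>i<N. \<Sum>j<N. 1 / real N * (1 / real N) * K (p i) (p j)) = (\<Sum>i<N. \<Sum>j<N. K (p i) (p j)) / (real N)\<^sup>2"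
    by (simp add: sum_divide_distrib power2_eq_square)
  have p': "\<And>i. i \<in> {..<N} \<Longrightarrow> p i \<in> X" using p by simp
  show B: "m \<le> (\<Sum>i<N. \<Sum>j<N. K (p i) (p j)) / (real N)\<^sup>2"
    using quadrature_error_nonneg[of "{..<N}" p "\<lambda>_. 1 / real N", OF finite_lessThan p' c] unfolding KK .
  have le: "?e f \<le> sqrt ?B" if "f \<in> ?A" for f
  proof -
    have f: "f \<in> H" "ip f f \<le> 1" using that by (auto simp: ip_norm_def)
    have "(?e f)\<^sup>2 \<le> ip f f * ?B"
      using quadrature_error[of "{..<N}" p "\<lambda>_. 1 / real N", OF finite_lessThan p' c f(1)]
      unfolding KK by (simp add: sum_divide_distrib[of "\<lambda>i. f (p i)"])
    also have "\<dots> \<le> ?B" using B f(2) mult_right_mono[of "ip f f" 1 ?B] by simp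
    finally show ?thesis by (rule real_le_rsqrt)
  qed
  \<comment> \<open>The zero function makes the set nonempty and, together with boundedness, the
    supremum nonnegative, so that the inequality may be squared.\<close>
  have 0: "(\<lambda>x. 0) \<in> ?A" using zero_mem ip_zero[OF zero_mem] by (simp add: ip_norm_def)
  have "(SUP f\<in>?A. ?e f) \<le> sqrt ?B" using 0 le by (intro cSUP_least) auto
  moreover have "bdd_above (?e ` ?A)" using le by (rule bdd_aboveI2)
  then have "0 \<le> (SUP f\<in>?A. ?e f)" by (rule order_trans[OF abs_ge_zero cSUP_upper[OF 0]])
  ultimately have "(SUP f\<in>?A. ?e f)\<^sup>2 \<le> (sqrt ?B)\<^sup>2" by (intro power_mono)
  then show "(SUP f\<in>?A. ?e f)\<^sup>2 \<le> ?B" using B by simp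
qed

lemma initial_error_ge:
  assumes "1 \<le> \<alpha>" "rkhs (cube s) (sobolev_kernel s \<alpha> \<gamma>) H ip" "0 < \<gamma> {}"
  shows "sqrt (\<gamma> {}) \<le> initial_error s H ip"
proof -
  obtain C where "rkhs_prob (cube s) (sobolev_kernel s \<alpha> \<gamma>) H ip (cube_measure s) (grid_point s) C (\<gamma> {})"
    using rkhs_prob_sobolev[OF assms(1,2)] by blast
  from rkhs_prob.sqrt_le_SUP_integral[OF this assms(3)] show ?thesis
    unfolding initial_error_def set_integral_cube .
qed

text \<open>Each of the finitely many coordinates of the N points can reach 1 only for a null set of
  shifts.\<close>

lemma AE_digital_shift_in_cube:
  fixes N :: nat
  assumes "2 \<le> b" "\<And>i. i < N \<Longrightarrow> p i \<in> cube s"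
  shows "AE \<sigma> in cube_measure s. \<forall>i<N. digital_shift b s \<sigma> (p i) \<in> cube s"
proof -
  have "AE \<sigma> in cube_measure s. digit_add b (p i j) (\<sigma> j) < 1" if "j \<in> {1..s}" for i j
    using that AE_digit_add_less_1[OF assms(1), of "p i j"] by (rule AE_cube_component) measurable
  then have "AE \<sigma> in cube_measure s. \<forall>i\<in>{..<N}. \<forall>j\<in>{1..s}. digit_add b (p i j) (\<sigma> j) < 1"
    by (intro AE_finite_allI) auto
  then show ?thesis
    by eventually_elim (use digit_add_bounds[OF assms(1)] in \<open>auto simp: digital_shift_def cube_def\<close>)
qed

lemma exists_rms_error_le:
  assumes b: "2 \<le> b" and \<alpha>: "1 \<le> \<alpha>" and N: "1 \<le> N"
    and H: "rkhs (cube s) (sobolev_kernel s \<alpha> \<gamma>) H ip"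
  shows "\<exists>P. size P = N \<and> set_mset P \<subseteq> cube s \<and> rms_error b s H ip P \<le> sqrt (shift_variance s \<alpha> \<gamma> / real N)"
proof -
  obtain C where C: "rkhs_prob (cube s) (sobolev_kernel s \<alpha> \<gamma>) H ip (cube_measure s) (grid_point s) C (\<gamma> {})"
    using rkhs_prob_sobolev[OF \<alpha> H] by blast
  interpret rkhs_prob "cube s" "sobolev_kernel s \<alpha> \<gamma>" H ip "cube_measure s" "grid_point s" C "\<gamma> {}" by (rule C)
  obtain p where p: "\<And>i. i < N \<Longrightarrow> p i \<in> cube s"
    and le: "(\<Sum>i<N. \<Sum>j<N. \<Sum>u\<in>Pow {1..s} - {{}}. \<gamma> u * (\<Prod>k\<in>u. shifted_kernel b \<alpha> (p i k) (p j k)))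
      \<le> real N * shift_variance s \<alpha> \<gamma>"
    using exists_shifted_points[OF b \<alpha>, of N s \<gamma>] by blast
  define P where "P = image_mset p (mset_set {..<N})"
  define K where "K \<sigma> i j = sobolev_kernel s \<alpha> \<gamma> (digital_shift b s \<sigma> (p i)) (digital_shift b s \<sigma> (p j))" for \<sigma> i j
  define G where "G \<sigma> = (\<Sum>i<N. \<Sum>j<N. K \<sigma> i j) / (real N)\<^sup>2 - \<gamma> {}" for \<sigma>
  have wce: "worst_case_error s H ip (image_mset (digital_shift b s \<sigma>) P)
      = (SUP f\<in>{f \<in> H. ip_norm ip f \<le> 1}.
          \<bar>integral\<^sup>L (cube_measure s) f - (\<Sum>i<N. f (digital_shift b s \<sigma> (p i))) / real N\<bar>)" for \<sigma>
    unfolding worst_case_error_def set_integral_cube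
    by (simp add: P_def sum_unfold_sum_mset[symmetric] multiset.map_comp comp_def)
  \<comment> \<open>Measurability of the squared error as a function of the shift is not
    established. If it is not integrable, its integral is 0 by convention, and the part
    \<open>0 \<le> G \<sigma>\<close> still yields the comparison of integrals.\<close>
  have bound: "AE \<sigma> in cube_measure s.
      (worst_case_error s H ip (image_mset (digital_shift b s \<sigma>) P))\<^sup>2 \<le> G \<sigma> \<and> 0 \<le> G \<sigma>"
  proof -
    have "AE \<sigma> in cube_measure s. \<forall>i<N. digital_shift b s \<sigma> (p i) \<in> cube s"
      using b p by (rule AE_digital_shift_in_cube)
    then show ?thesis
    proof eventually_elim
    case (elim \<sigma>)
    then show ?case
      unfolding wce G_def K_def
      using quadrature_sup_le[OF N, of "\<lambda>i. digital_shift b s \<sigma> (p i)"] by simp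
    qed
  qed
  obtain B where B: "\<And>x y. x \<in> {0..1} \<Longrightarrow> y \<in> {0..1} \<Longrightarrow> \<bar>unit_kernel \<alpha> x y\<bar> \<le> B"
    using unit_kernel_bounded[of \<alpha>] by blast
  have int1: "integrable unit_measure (\<lambda>t. unit_kernel \<alpha> (digit_add b x t) (digit_add b y t))" for x y
    using B digit_add_bounds[OF b] by (intro integrable_unit_measure[where B = B]) auto
  have K_eq: "K \<sigma> i j = (\<Sum>u\<in>Pow {1..s}. \<gamma> u * (\<Prod>k\<in>u. unit_kernel \<alpha> (digit_add b (p i k) (\<sigma> k)) (digit_add b (p j k) (\<sigma> k))))"
    for \<sigma> i j
    unfolding K_def sobolev_kernel_eq
    by (intro sum.cong arg_cong2[of _ _ _ _ "(*)"] prod.cong refl) (auto simp: digital_shift_def)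
  have int2: "integrable (cube_measure s)
      (\<lambda>\<sigma>. \<gamma> u * (\<Prod>k\<in>u. unit_kernel \<alpha> (digit_add b (p i k) (\<sigma> k)) (digit_add b (p j k) (\<sigma> k))))"
    if "u \<subseteq> {1..s}" for u i j
    using that by (intro integrable_mult_right integrable_cube_prod int1)
  have intK: "integrable (cube_measure s) (\<lambda>\<sigma>. K \<sigma> i j)" for i j
    unfolding K_eq using int2 by (intro Bochner_Integration.integrable_sum) auto
  have K_int: "(LINT \<sigma>|cube_measure s. K \<sigma> i j)
      = \<gamma> {} + (\<Sum>u\<in>Pow {1..s} - {{}}. \<gamma> u * (\<Prod>k\<in>u. shifted_kernel b \<alpha> (p i k) (p j k)))" for i j
  proof -
    have "(LINT \<sigma>|cube_measure s. K \<sigma> i j)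
        = (\<Sum>u\<in>Pow {1..s}. \<gamma> u * (LINT \<sigma>|cube_measure s.
            (\<Prod>k\<in>u. unit_kernel \<alpha> (digit_add b (p i k) (\<sigma> k)) (digit_add b (p j k) (\<sigma> k)))))"
      unfolding K_eq using int2 by (subst Bochner_Integration.integral_sum) auto
    also have "\<dots> = (\<Sum>u\<in>Pow {1..s}. \<gamma> u * (\<Prod>k\<in>u. shifted_kernel b \<alpha> (p i k) (p j k)))"
      unfolding shifted_kernel_def
      using int1 by (intro sum.cong arg_cong2[of _ _ _ _ "(*)"] refl integral_cube_prod) auto
    also have "\<dots> = \<gamma> {} + (\<Sum>u\<in>Pow {1..s} - {{}}. \<gamma> u * (\<Prod>k\<in>u. shifted_kernel b \<alpha> (p i k) (p j k)))"
      by (subst sum.remove[of _ "{}"]) auto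
    finally show ?thesis .
  qed
  have intG: "integrable (cube_measure s) G"
    unfolding G_def using intK by (intro Bochner_Integration.integrable_diff integrable_divide) auto
  have "(LINT \<sigma>|cube_measure s. (worst_case_error s H ip (image_mset (digital_shift b s \<sigma>) P))\<^sup>2)
      \<le> integral\<^sup>L (cube_measure s) G"
    using bound by (intro integral_mono_AE' intG) auto
  also have "integral\<^sup>L (cube_measure s) G = (\<Sum>i<N. \<Sum>j<N. LINT \<sigma>|cube_measure s. K \<sigma> i j) / (real N)\<^sup>2 - \<gamma> {}"
    unfolding G_def using intK prob_space by simp
  \<comment> \<open>Each of the N^2 pairs contributes \<open>\<gamma> {}\<close>; divided by N^2
    this cancels the subtracted term.\<close>
  also have "\<dots> = (\<Sum>i<N. \<Sum>j<N. \<Sum>u\<in>Pow {1..s} - {{}}. \<gamma> u * (\<Prod>k\<in>u. shifted_kernel b \<alpha> (p i k) (p j k))) / (real N)\<^sup>2"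
    using N by (simp add: K_int sum.distrib add_divide_distrib power2_eq_square)
  also have "\<dots> \<le> real N * shift_variance s \<alpha> \<gamma> / (real N)\<^sup>2"
    by (intro divide_right_mono le) simp
  also have "\<dots> = shift_variance s \<alpha> \<gamma> / real N" using N by (simp add: power2_eq_square)
  finally have "rms_error b s H ip P \<le> sqrt (shift_variance s \<alpha> \<gamma> / real N)"
    unfolding rms_error_def set_integral_cube by (rule real_sqrt_le_mono)
  moreover have "size P = N" "set_mset P \<subseteq> cube s" using p by (auto simp: P_def)
  ultimately show ?thesis by blast
qed

section \<open>Tractability\<close>

lemma sin_pi_div_pos: "2 \<le> b \<Longrightarrow> 0 < sin (pi / real b)"
  by (rule sin_gt_zero) (auto simp: field_simps)

text \<open>Equality holds at b = 3, which dictates the constant 9/4. From b = 5 on, sin x \<le> x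
  and pi \<le> 16/5 are enough. The bound serves to make \<open>D_const\<close> at least
  b/9.\<close>

lemma sin_pi_div_sq_le:
  assumes "2 \<le> b"
  shows "(sin (pi / real b))\<^sup>2 \<le> 9 / (4 * real b)"
proof -
  consider "b = 2" | "b = 3" | "b = 4" | "5 \<le> b" using assms by linarith
  then show ?thesis
  proof cases
    case 4
    have pi: "pi \<le> 16 / 5" using pi_approx by (simp add: abs_le_iff)
    have "(sin (pi / real b))\<^sup>2 \<le> (pi / real b)\<^sup>2"
      using sin_pi_div_pos[OF assms] 4 by (intro power_mono sin_x_le_x) auto
    also have "\<dots> = pi\<^sup>2 / (real b * real b)" by (simp add: power2_eq_square)
    also have "\<dots> \<le> (16 / 5)\<^sup>2 / (5 * real b)"
      using pi 4 pi_gt_zero by (intro frac_le power_mono mult_right_mono) auto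
    also have "\<dots> \<le> 9 / (4 * real b)" using 4 by (simp add: field_simps power2_eq_square)
    finally show ?thesis .
  qed (auto simp: sin_60 sin_45 power_divide)
qed

text \<open>Keep only \<nu> = 1 in the maximum and \<tau> = 1 in the sum.\<close>

lemma D_const_ge:
  assumes "2 \<le> b" "1 \<le> \<alpha>"
  shows "1 / (4 * (sin (pi / real b))\<^sup>2) \<le> D_const \<alpha> b"
proof -
  let ?E = "\<lambda>\<nu>. C1_sum_const \<alpha> b \<nu> + C2_const \<alpha> b / real b ^ (2 * (\<alpha> - \<nu>))"
  have "0 \<le> C2_const \<alpha> b"
    using sin_pi_div_pos[OF assms(1)]
    by (auto simp: C2_const_def intro!: divide_nonneg_nonneg zero_le_power mult_nonneg_nonneg)
  then have "C1_sum_const \<alpha> b 1 \<le> ?E 1" by simp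
  moreover have "?E 1 \<le> D_const \<alpha> b" unfolding D_const_def using assms(2) by (intro Max_ge) auto
  moreover have "(C1_const b 1)\<^sup>2 / real b ^ (2 * (1 - 1)) \<le> C1_sum_const \<alpha> b 1"
    unfolding C1_sum_const_def using assms(2) by (intro member_le_sum) auto
  ultimately show ?thesis by (simp add: C1_const_def power_divide power_mult_distrib)
qed

text \<open>The second factor, raised to the power lam, is the part of \<open>C_const\<close> coming
  from the first entry of its maximum. Since \<open>D_const\<close> supplies b/9, the remaining
  factors have to supply 1/b.\<close>

lemma G_base_ge:
  assumes b: "2 \<le> b" and \<alpha>: "2 \<le> \<alpha>" and d: "1 \<le> d"
  shows "1 / 9 \<le> D_tilde_const \<alpha> b d * (real b powr (- real \<alpha>) * ((real b - 1) / (real b ^ (2 * min \<alpha> d) - real b)))"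
proof -
  let ?R = "(real b - 1) / (real b ^ (2 * min \<alpha> d) - real b)"
  have "real b ^ 1 < real b ^ (2 * min \<alpha> d)" using b \<alpha> d by (intro power_strict_increasing) auto
  then have pos: "0 < real b ^ (2 * min \<alpha> d) - real b" by simp
  then have R: "0 \<le> ?R" using b by simp
  have "(2 * d - 1) * \<alpha> = (2 * d - 2) * \<alpha> + \<alpha>"
    using d by (cases d) auto
  then have "real b ^ ((2 * d - 1) * \<alpha>) * real b powr (- real \<alpha>) = real b ^ ((2 * d - 2) * \<alpha>)"
    using b by (simp add: power_add powr_minus powr_realpow)
  then have eq: "D_tilde_const \<alpha> b d * (real b powr (- real \<alpha>) * ?R) = D_const \<alpha> b * (real b ^ ((2 * d - 2) * \<alpha>) * ?R)"
    by (simp add: D_tilde_const_def mult_ac)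
  have D: "real b / 9 \<le> D_const \<alpha> b"
  proof -
    have "real b / 9 \<le> 1 / (4 * (sin (pi / real b))\<^sup>2)"
      using sin_pi_div_sq_le[OF b] sin_pi_div_pos[OF b] b by (simp add: field_simps)
    also have "\<dots> \<le> D_const \<alpha> b" using b \<alpha> by (intro D_const_ge) auto
    finally show ?thesis .
  qed
  \<comment> \<open>For d = 1 this is an equality. For d \<ge> 2 the exponent on the right is at
    least 2 min(\<alpha>, d), so the product even reaches b - 1 \<ge> 1.\<close>
  have "1 / real b \<le> real b ^ ((2 * d - 2) * \<alpha>) * ?R"
  proof (cases "d = 1")
    case True
    then have "min \<alpha> d = 1" using \<alpha> by simp
    then have "?R = (real b - 1) / (real b * (real b - 1))" by (simp add: power2_eq_square algebra_simps)
    then show ?thesis using True b by simp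
  next
    case False
    then obtain e where e: "d = Suc (Suc e)" using d by (metis One_nat_def Suc_le_D not0_implies_Suc)
    have "2 * min \<alpha> d \<le> (2 * d - 2) * \<alpha>"
    proof (cases "\<alpha> \<le> d")
      case True
      then show ?thesis by (simp add: e)
    next
      case False
      have "2 * (e + 2) \<le> (2 * e + 2) * 2" by simp
      also have "\<dots> \<le> (2 * e + 2) * \<alpha>" using \<alpha> by (intro mult_le_mono2)
      finally show ?thesis using False by (simp add: e)
    qed
    then have "real b ^ (2 * min \<alpha> d) \<le> real b ^ ((2 * d - 2) * \<alpha>)" using b by (intro power_increasing) auto
    then have "real b ^ (2 * min \<alpha> d) - real b \<le> real b ^ ((2 * d - 2) * \<alpha>)" by simp
    then have "1 \<le> real b ^ ((2 * d - 2) * \<alpha>) / (real b ^ (2 * min \<alpha> d) - real b)" using pos by simp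
    moreover have "1 / real b \<le> 1" "1 \<le> real b - 1" using b by simp_all
    ultimately have "1 / real b \<le> real b ^ ((2 * d - 2) * \<alpha>) / (real b ^ (2 * min \<alpha> d) - real b) * (real b - 1)"
      using mult_mono[of 1 "real b ^ ((2 * d - 2) * \<alpha>) / (real b ^ (2 * min \<alpha> d) - real b)" 1 "real b - 1"] by linarith
    then show ?thesis by (simp add: mult_ac)
  qed
  then have "real b / 9 * (1 / real b) \<le> D_const \<alpha> b * (real b ^ ((2 * d - 2) * \<alpha>) * ?R)"
    using D b by (intro mult_mono) auto
  then show ?thesis unfolding eq using b by simp
qed

text \<open>Bounding (1 + C)^d below by 1 + C, and the maximum in C by its first entry, leaves the
  power lam of the quantity in \<open>G_base_ge\<close>.\<close>

lemma G_const_ge: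
  assumes b: "2 \<le> b" and \<alpha>: "2 \<le> \<alpha>" and d: "1 \<le> d" and lam: "0 < lam"
  shows "(1 / 9) powr lam \<le> G_const b \<alpha> d lam"
proof -
  let ?R = "(real b - 1) / (real b ^ (2 * min \<alpha> d) - real b)"
  have "real b ^ 1 < real b ^ (2 * min \<alpha> d)" using b \<alpha> d by (intro power_strict_increasing) auto
  then have R: "0 \<le> ?R" using b by simp
  have "0 < 1 / (4 * (sin (pi / real b))\<^sup>2)" using sin_pi_div_pos[OF b] by simp
  also have "\<dots> \<le> D_const \<alpha> b" using b \<alpha> by (intro D_const_ge) auto
  finally have D: "0 \<le> D_tilde_const \<alpha> b d" by (simp add: D_tilde_const_def)
  have C: "real b powr (- (\<alpha> * lam)) * ?R powr lam \<le> C_const b \<alpha> d lam"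
    unfolding C_const_def by (intro mult_left_mono) auto
  then have C0: "0 \<le> C_const b \<alpha> d lam" by (rule order_trans[rotated]) simp
  have "(1 / 9) powr lam \<le> (D_tilde_const \<alpha> b d * (real b powr (- real \<alpha>) * ?R)) powr lam"
    using G_base_ge[OF b \<alpha> d] lam by (intro powr_mono2) auto
  also have "\<dots> = D_tilde_const \<alpha> b d powr lam * (real b powr (- (\<alpha> * lam)) * ?R powr lam)"
    using D R by (simp only: powr_mult mult_nonneg_nonneg powr_ge_zero powr_powr) simp
  also have "\<dots> \<le> D_tilde_const \<alpha> b d powr lam * (- 1 + (1 + C_const b \<alpha> d lam) ^ d)"
  proof (rule mult_left_mono)
    have "(1 + C_const b \<alpha> d lam) ^ 1 \<le> (1 + C_const b \<alpha> d lam) ^ d"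
      using d C0 by (intro power_increasing) auto
    then show "real b powr (- (\<alpha> * lam)) * ?R powr lam \<le> - 1 + (1 + C_const b \<alpha> d lam) ^ d"
      using C by simp
  qed simp
  finally show ?thesis by (simp add: G_const_def)
qed

section \<open>From the weight sum to the number of points\<close>

lemma weight_sum_nonneg:
  assumes "2 \<le> b" "2 \<le> \<alpha>" "1 \<le> d" "0 < lam"
  shows "0 \<le> weight_sum b \<alpha> d \<gamma> lam s"
  unfolding weight_sum_def
  using order_trans[OF powr_ge_zero G_const_ge[OF assms]]
  by (intro sum_nonneg mult_nonneg_nonneg zero_le_power) auto

text \<open>Write \<open>a i powr (1 / lam)\<close> as \<open>a i\<close> times its power 1 / lam -
  1. That exponent is nonnegative, so the second factor grows when \<open>a i\<close> is replaced by
  the total W; the first factors then add up to W.\<close>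

lemma sum_le_sum_powr:
  fixes t a :: "'i \<Rightarrow> real"
  assumes lam: "0 < lam" "lam \<le> 1" and S: "finite S"
    and t: "\<And>i. i \<in> S \<Longrightarrow> 0 \<le> t i" "\<And>i. i \<in> S \<Longrightarrow> t i powr lam \<le> a i"
  shows "sum t S \<le> sum a S powr (1 / lam)"
proof -
  have a: "0 \<le> a i" if "i \<in> S" for i
    using t(2)[OF that] by (rule order_trans[rotated]) simp
  let ?W = "sum a S"
  have "t i \<le> a i * ?W powr (1 / lam - 1)" if "i \<in> S" for i
  proof -
    have "t i = (t i powr lam) powr (1 / lam)" using t(1)[OF that] lam by (simp add: powr_powr)
    also have "\<dots> \<le> a i powr (1 / lam)" using t(2)[OF that] lam by (intro powr_mono2) auto
    also have "\<dots> = a i powr (1 + (1 / lam - 1))" by simp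
    also have "\<dots> = a i * a i powr (1 / lam - 1)"
      unfolding powr_add using a[OF that] by simp
    also have "\<dots> \<le> a i * ?W powr (1 / lam - 1)"
      using a that S lam by (intro mult_left_mono powr_mono2 member_le_sum) auto
    finally show ?thesis .
  qed
  then have "sum t S \<le> (\<Sum>i\<in>S. a i * ?W powr (1 / lam - 1))" by (rule sum_mono)
  also have "\<dots> = ?W * ?W powr (1 / lam - 1)" by (simp add: sum_distrib_right)
  also have "\<dots> = ?W powr (1 + (1 / lam - 1))"
    unfolding powr_add using a by (simp add: sum_nonneg)
  finally show ?thesis by simp
qed

lemma shift_variance_le_weight_sum:
  assumes b: "2 \<le> b" and \<alpha>: "2 \<le> \<alpha>" and d: "1 \<le> d" and lam: "0 < lam" "lam \<le> 1"
    and \<gamma>: "\<And>u. finite u \<Longrightarrow> 0 \<notin> u \<Longrightarrow> 0 \<le> \<gamma> u"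
  shows "shift_variance s \<alpha> \<gamma> \<le> weight_sum b \<alpha> d \<gamma> lam s powr (1 / lam)"
proof -
  let ?S = "Pow {1..s} - {{}}"
  let ?c = "integral {0..1} (\<lambda>t. unit_kernel \<alpha> t t)"
  have \<gamma>0: "0 \<le> \<gamma> u" if "u \<in> ?S" for u
  proof -
    have "finite u" "0 \<notin> u" using that finite_subset[of u "{1..s}"] by auto
    then show ?thesis by (rule \<gamma>)
  qed
  have "shift_variance s \<alpha> \<gamma> \<le> (\<Sum>u\<in>?S. \<gamma> u * (1 / 9) ^ card u)"
    unfolding shift_variance_def
  proof (intro sum_mono mult_left_mono \<gamma>0)
    fix u :: "nat set"
    \<comment> \<open>Only the absolute value of the diagonal mean has been bounded; its sign is
      left open.\<close>
    have "?c ^ card u \<le> \<bar>?c\<bar> ^ card u" by (metis abs_ge_self power_abs)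
    also have "\<dots> \<le> (1 / 9) ^ card u" using unit_kernel_diag_integral[OF \<alpha>] by (intro power_mono) auto
    finally show "?c ^ card u \<le> (1 / 9) ^ card u" .
  qed
  also have "\<dots> \<le> (\<Sum>u\<in>?S. \<gamma> u powr lam * G_const b \<alpha> d lam ^ card u) powr (1 / lam)"
  proof (rule sum_le_sum_powr[OF lam])
    fix u assume u: "u \<in> ?S"
    show "0 \<le> \<gamma> u * (1 / 9) ^ card u" using \<gamma>0[OF u] by simp
    have "(\<gamma> u * (1 / 9) ^ card u) powr lam = \<gamma> u powr lam * ((1 / 9) powr lam) ^ card u"
      using \<gamma>0[OF u] by (simp add: powr_mult powr_powr powr_realpow[symmetric] mult.commute)
    also have "\<dots> \<le> \<gamma> u powr lam * G_const b \<alpha> d lam ^ card u"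
      using G_const_ge[OF b \<alpha> d lam(1)] by (intro mult_left_mono power_mono) auto
    finally show "(\<gamma> u * (1 / 9) ^ card u) powr lam \<le> \<gamma> u powr lam * G_const b \<alpha> d lam ^ card u" .
  qed simp
  finally show ?thesis by (simp add: weight_sum_def)
qed

text \<open>The mean square error is at most V / N, while the squared initial error is at least
  \<open>\<gamma> {}\<close>. Hence any N \<ge> 1 that is at least V divided by
  \<open>\<epsilon>\<^sup>2 * \<gamma> {}\<close> works.\<close>

lemma min_points_le:
  assumes b: "2 \<le> b" and \<alpha>: "1 \<le> \<alpha>" and \<gamma>: "0 < \<gamma> {}" and \<epsilon>: "0 < \<epsilon>"
    and H: "rkhs (cube s) (sobolev_kernel s \<alpha> \<gamma>) H ip"
    and V: "shift_variance s \<alpha> \<gamma> \<le> V"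
  shows "min_points b s H ip \<epsilon> \<le> enat (Suc (nat \<lceil>V / (\<epsilon>\<^sup>2 * \<gamma> {})\<rceil>))"
proof -
  \<comment> \<open>\<open>Suc\<close> guarantees at least one point, also when V is 0.\<close>
  let ?N = "Suc (nat \<lceil>V / (\<epsilon>\<^sup>2 * \<gamma> {})\<rceil>)"
  obtain P where P: "size P = ?N" "set_mset P \<subseteq> cube s"
    and rms: "rms_error b s H ip P \<le> sqrt (shift_variance s \<alpha> \<gamma> / real ?N)"
    using exists_rms_error_le[OF b \<alpha> _ H, of ?N] by auto
  have "V / (\<epsilon>\<^sup>2 * \<gamma> {}) \<le> real ?N" by linarith
  then have "V \<le> real ?N * (\<epsilon>\<^sup>2 * \<gamma> {})"
    using \<epsilon> \<gamma> by (subst (asm) pos_divide_le_eq) auto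
  then have "shift_variance s \<alpha> \<gamma> / real ?N \<le> \<epsilon>\<^sup>2 * \<gamma> {}"
    using V by (subst pos_divide_le_eq) (auto simp: mult_ac)
  then have "sqrt (shift_variance s \<alpha> \<gamma> / real ?N) \<le> sqrt (\<epsilon>\<^sup>2 * \<gamma> {})"
    by (rule real_sqrt_le_mono)
  also have "\<dots> = \<epsilon> * sqrt (\<gamma> {})" using \<epsilon> by (simp add: real_sqrt_mult)
  also have "\<dots> \<le> \<epsilon> * initial_error s H ip"
    using \<epsilon> initial_error_ge[OF \<alpha> H \<gamma>] by (intro mult_left_mono) auto
  finally have "rms_error b s H ip P \<le> \<epsilon> * initial_error s H ip" using rms by linarith
  with P show ?thesis unfolding min_points_def by (intro Inf_lower) auto
qed

text \<open>The limsup controls only large s. The finitely many other values are covered by the sum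
  of their absolute values, because \<open>real s powr q\<close> is at least 1.\<close>

lemma poly_growth_of_limsup:
  fixes W :: "nat \<Rightarrow> real"
  assumes "limsup (\<lambda>s. ereal (1 / (real s powr q) * W s)) < \<infinity>" "0 < q"
  shows "\<exists>A\<ge>0. \<forall>s\<ge>1. W s \<le> A * real s powr q"
proof -
  obtain c where c: "limsup (\<lambda>s. ereal (1 / (real s powr q) * W s)) < ereal c"
    using assms(1) less_PInf_Ex_of_nat by auto
  then have "\<forall>\<^sub>F s in sequentially. ereal (1 / (real s powr q) * W s) < ereal c"
    by (rule Limsup_lessD)
  then obtain S where S: "\<And>s. S \<le> s \<Longrightarrow> 1 / (real s powr q) * W s < c"
    by (auto simp: eventually_sequentially)
  define A where "A = \<bar>c\<bar> + (\<Sum>s<S. \<bar>W s\<bar>)"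
  have sum0: "0 \<le> (\<Sum>s<S. \<bar>W s\<bar>)" by (intro sum_nonneg) auto
  have "W s \<le> A * real s powr q" if "1 \<le> s" for s
  proof (cases "S \<le> s")
    case True
    have "0 < real s powr q" using that by simp
    then have "W s \<le> c * real s powr q" using S[OF True] by (simp add: field_simps)
    also have "\<dots> \<le> A * real s powr q"
    proof (rule mult_right_mono)
      show "c \<le> A" unfolding A_def using sum0 by linarith
    qed simp
    finally show ?thesis .
  next
    case False
    then have "\<bar>W s\<bar> \<le> (\<Sum>s<S. \<bar>W s\<bar>)" by (intro member_le_sum) auto
    then have "W s \<le> A" by (simp add: A_def)
    also have "\<dots> \<le> A * real s powr q"
      using that assms(2) sum0 mult_left_mono[of 1 "real s powr q" A] ge_one_powr_ge_zero[of "real s" q]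
      by (simp add: A_def)
    finally show ?thesis .
  qed
  moreover have "0 \<le> A" using sum0 by (simp add: A_def)
  ultimately show ?thesis by blast
qed

theorem corollary2:
  fixes b \<alpha> d :: nat
    and \<gamma> :: "nat set \<Rightarrow> real"
    and H :: "nat \<Rightarrow> ((nat \<Rightarrow> real) \<Rightarrow> real) set"
    and ip :: "nat \<Rightarrow> ((nat \<Rightarrow> real) \<Rightarrow> real) \<Rightarrow> ((nat \<Rightarrow> real) \<Rightarrow> real) \<Rightarrow> real"
  assumes "prime b" and "2 \<le> \<alpha>" and "1 \<le> d"
    and "\<And>u. finite u \<Longrightarrow> 0 \<notin> u \<Longrightarrow> 0 \<le> \<gamma> u"
    and "0 < \<gamma> {}"
    and "\<And>s. 1 \<le> s \<Longrightarrow> rkhs (cube s) (sobolev_kernel s \<alpha> \<gamma>) (H s) (ip s)"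
  shows "((\<exists>lam\<in>{1 / (2 * real (min \<alpha> d))<..1}. convergent (weight_sum b \<alpha> d \<gamma> lam)) \<longrightarrow>
           (\<forall>\<epsilon>>0. \<exists>B::nat. \<forall>s\<ge>1. min_points b s (H s) (ip s) \<epsilon> \<le> enat B))
       \<and> ((\<exists>lam\<in>{1 / (2 * real (min \<alpha> d))<..1}. \<exists>q>0.
             limsup (\<lambda>s. ereal (1 / (real s powr q) * weight_sum b \<alpha> d \<gamma> lam s)) < \<infinity>) \<longrightarrow>
           (\<forall>\<epsilon>>0. \<exists>p :: real poly. \<forall>s\<ge>1.
             ereal_of_enat (min_points b s (H s) (ip s) \<epsilon>) \<le> ereal (poly p (real s))))"
proof -
  have b: "2 \<le> b" using assms(1) by (rule prime_ge_2_nat)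
  have \<alpha>: "1 \<le> \<alpha>" using assms(2) by simp
  have lam_pos: "0 < lam" "lam \<le> 1" if "lam \<in> {1 / (2 * real (min \<alpha> d))<..1}" for lam :: real
  proof -
    have "0 \<le> 1 / (2 * real (min \<alpha> d))" by simp
    then show "0 < lam" "lam \<le> 1" using that unfolding greaterThanAtMost_iff by linarith+
  qed
  note V_le = shift_variance_le_weight_sum[OF b assms(2,3) _ _ assms(4)]
  show ?thesis
  proof (intro conjI impI allI; elim bexE exE conjE)
    fix lam \<epsilon> :: real
    assume lam: "lam \<in> {1 / (2 * real (min \<alpha> d))<..1}"
      and conv: "convergent (weight_sum b \<alpha> d \<gamma> lam)" and \<epsilon>: "0 < \<epsilon>"
    obtain W where W: "\<And>s. \<bar>weight_sum b \<alpha> d \<gamma> lam s\<bar> \<le> W"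
      using convergent_imp_Bseq[OF conv] by (auto simp: Bseq_def)
    have "min_points b s (H s) (ip s) \<epsilon> \<le> enat (Suc (nat \<lceil>W powr (1 / lam) / (\<epsilon>\<^sup>2 * \<gamma> {})\<rceil>))" if "1 \<le> s" for s
    proof (rule min_points_le[OF b \<alpha> assms(5) \<epsilon> assms(6)[OF that]])
      have "shift_variance s \<alpha> \<gamma> \<le> weight_sum b \<alpha> d \<gamma> lam s powr (1 / lam)"
        using V_le[OF lam_pos[OF lam]] .
      also have "\<dots> \<le> W powr (1 / lam)"
        using abs_le_D1[OF W] weight_sum_nonneg[OF b assms(2,3)] lam_pos[OF lam] by (intro powr_mono2) auto
      finally show "shift_variance s \<alpha> \<gamma> \<le> W powr (1 / lam)" .
    qed
    then show "\<exists>B. \<forall>s\<ge>1. min_points b s (H s) (ip s) \<epsilon> \<le> enat B" by blast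
  next
    fix lam q \<epsilon> :: real
    assume lam: "lam \<in> {1 / (2 * real (min \<alpha> d))<..1}" and q: "0 < q"
      and ls: "limsup (\<lambda>s. ereal (1 / (real s powr q) * weight_sum b \<alpha> d \<gamma> lam s)) < \<infinity>" and \<epsilon>: "0 < \<epsilon>"
    obtain A where A: "0 \<le> A" "\<And>s. 1 \<le> s \<Longrightarrow> weight_sum b \<alpha> d \<gamma> lam s \<le> A * real s powr q"
      using poly_growth_of_limsup[OF ls q] by blast
    \<comment> \<open>Raising to the power 1 / lam turns growth of order s^q into s^(q / lam); the
      exponent is rounded up to obtain a polynomial.\<close>
    define n where "n = nat \<lceil>q / lam\<rceil>"
    define B where "B = A powr (1 / lam)"
    define E where "E = \<epsilon>\<^sup>2 * \<gamma> {}"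
    have E: "0 < E" using \<epsilon> assms(5) by (simp add: E_def)
    \<comment> \<open>The constant 2 pays for the ceiling and for \<open>Suc\<close> in
      \<open>min_points_le\<close>.\<close>
    define p where "p = monom (B / E) n + [:2:]"
    have "ereal_of_enat (min_points b s (H s) (ip s) \<epsilon>) \<le> ereal (poly p (real s))" if s: "1 \<le> s" for s
    proof -
      have "0 \<le> weight_sum b \<alpha> d \<gamma> lam s"
        by (rule weight_sum_nonneg[OF b assms(2,3) lam_pos(1)[OF lam]])
      then have "shift_variance s \<alpha> \<gamma> \<le> (A * real s powr q) powr (1 / lam)"
        using V_le[OF lam_pos[OF lam], where s = s] A(2)[OF s] lam_pos[OF lam]
        by (meson order_trans powr_mono2 zero_le_divide_1_iff less_imp_le)
      also have "\<dots> = B * real s powr (q / lam)"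
        using A(1) by (simp add: B_def powr_mult powr_powr)
      also have "\<dots> \<le> B * real s ^ n"
      proof (rule mult_left_mono)
        have "q / lam \<le> real n" unfolding n_def by linarith
        then have "real s powr (q / lam) \<le> real s powr real n" using s by (intro powr_mono) auto
        then show "real s powr (q / lam) \<le> real s ^ n" using s by (simp add: powr_realpow)
      qed (simp add: B_def)
      finally have "min_points b s (H s) (ip s) \<epsilon> \<le> enat (Suc (nat \<lceil>B * real s ^ n / E\<rceil>))"
        unfolding E_def by (rule min_points_le[OF b \<alpha> assms(5) \<epsilon> assms(6)[OF s]])
      then have "ereal_of_enat (min_points b s (H s) (ip s) \<epsilon>) \<le> ereal (real (Suc (nat \<lceil>B * real s ^ n / E\<rceil>)))"
        by (metis ereal_of_enat_le_iff ereal_of_enat_simps(1))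
      also have "real (Suc (nat \<lceil>B * real s ^ n / E\<rceil>)) \<le> poly p (real s)"
      proof -
        have "0 \<le> B * real s ^ n / E" using E by (simp add: B_def)
        then have "real (Suc (nat \<lceil>B * real s ^ n / E\<rceil>)) \<le> B * real s ^ n / E + 2" by linarith
        then show ?thesis by (simp add: p_def poly_monom)
      qed
      finally show ?thesis by simp
    qed
    then show "\<exists>p. \<forall>s\<ge>1. ereal_of_enat (min_points b s (H s) (ip s) \<epsilon>) \<le> ereal (poly p (real s))" by blast
  qed
qed

end
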